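(* Let $\{H_\Lambda\}$ be a thermodynamically stable Gaussian spin-glass Hamiltonian (see context). Let $R\ge 1$ be an integer, let $G$ be an observable of $R$ replicas, and let $0<\beta_1<\beta_2$. Then, in the thermodynamic limit $|\Lambda|\to\infty$, $$\int_{\beta_1^2}^{\beta_2^2}\Big\langle \sum_{\substack{k,l=1\\k\neq l}}^{R} G\, q_{l,k} - 2R\, G\sum_{l=1}^{R} q_{l,R+1} + R(R+1)\, G\, q_{R+1,R+2}\Big\rangle\, d\beta^2 \;\to\; 0$$ and $$\int_{\beta_1^2}^{\beta_2^2}\Big[\sum_{k=1}^{R}\langle G\, q_{k,R+1}\rangle - (R+1)\langle G\, q_{R+1,R+2}\rangle + \langle G\rangle\langle q_{1,2}\rangle\Big]\, d\beta^2 \;\to\; 0,$$ where all quenched expectations are taken at inverse temperature $\beta=\sqrt{\beta^2}$ and volume $\Lambda$.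
   Context: For each finite $d$-dimensional parallelepiped $\Lambda\subset\mathbb{Z}^d$ let $\Sigma_\Lambda=\{-1,1\}^\Lambda$, and for $X\subset\Lambda$ let $\sigma_X=\prod_{i\in X}\sigma_i$ (with $\sigma_\emptyset=0$). Let $\{J_X\}$ be independent centered Gaussian random variables with variances $\mathrm{Av}(J_X^2)=\Delta_X^2$, translation invariant ($\Delta^2_{X+a}=\Delta^2_X$), where $\mathrm{Av}$ denotes expectation over the $J$'s. The Hamiltonian is $H_\Lambda(\sigma)=-\sum_{X\subset\Lambda}J_X\sigma_X$. Its covariance is $\mathcal{C}_\Lambda(\sigma,\tau)=\mathrm{Av}(H_\Lambda(\sigma)H_\Lambda(\tau))=\sum_{X\subset\Lambda}\Delta_X^2\sigma_X\tau_X$, and the normalized covariance is $c_\Lambda(\sigma,\tau)=\mathcal{C}_\Lambda(\sigma,\tau)/|\Lambda|$. The Hamiltonian is thermodynamically stable if there is $\bar c<\infty$ with $\sup_{\Lambda}\frac{1}{|\Lambda|}\sum_{X\subset\Lambda}\Delta_X^2\le\bar c$. Let $\mathcal{Z}(\beta)=\sum_{\sigma\in\Sigma_\Lambda}e^{-\beta H_\Lambda(\sigma)}$. For $n\ge1$ the $n$-replica random Gibbs state is $\Omega_n(f)=\sum_{\sigma^{(1)},\dots,\sigma^{(n)}}f(\sigma^{(1)},\dots,\sigma^{(n)})\,e^{-\beta\sum_{i=1}^n H_\Lambda(\sigma^{(i)})}/\mathcal{Z}(\beta)^n$, and the quenched state is $\langle f\rangle=\mathrm{Av}(\Omega_n(f))$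 (with $n$ large enough for $f$). An observable of $R$ replicas is a smooth function $G$ of an $R\times R$ real matrix with $|G|\le 1$ (no permutation symmetry assumed), evaluated at the matrix $(c_\Lambda(\sigma^{(k)},\sigma^{(l)}))_{k,l\le R}$. The generalized overlap notation means: $\langle G\rangle=\mathrm{Av}\,\Omega_R(G(c_\Lambda))$, $\langle G\,q_{k,l}\rangle=\mathrm{Av}\,\Omega_n\big(G((c_\Lambda(\sigma^{(i)},\sigma^{(j)}))_{i,j\le R})\,c_\Lambda(\sigma^{(k)},\sigma^{(l)})\big)$ with $n=\max(R,k,l)$, and $\langle q_{1,2}\rangle=\mathrm{Av}\,\Omega_2(c_\Lambda(\sigma^{(1)},\sigma^{(2)}))$. The thermodynamic limit is the limit along boxes $\Lambda$ with $|\Lambda|\to\infty$. *)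

theory Defs
  imports "HOL-Probability.Probability"
begin

text \<open>Sites of Z^d are functions 'd => int for a finite index type 'd (d = CARD('d)).\<close>

definition box :: "('d::finite \<Rightarrow> int) set \<Rightarrow> bool" where
  "box \<Lambda> \<longleftrightarrow> (\<exists>a L. (\<forall>i. L i \<ge> 1) \<and> \<Lambda> = {x. \<forall>i. a i \<le> x i \<and> x i < a i + L i})"

definition translate :: "('d \<Rightarrow> int) \<Rightarrow> ('d \<Rightarrow> int) set \<Rightarrow> ('d \<Rightarrow> int) set" where
  "translate a X = (\<lambda>x. (\<lambda>i. x i + a i)) ` X"

definition sigmaX :: "(('d \<Rightarrow> int) \<Rightarrow> real) \<Rightarrow> ('d \<Rightarrow> int) set \<Rightarrow> real"
  where "sigmaX \<sigma> X = (if X = {} then 0 else (\<Prod>i\<in>X. \<sigma> i))"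

definition configs :: "('d \<Rightarrow> int) set \<Rightarrow> (('d \<Rightarrow> int) \<Rightarrow> real) set" where
  "configs \<Lambda> = PiE \<Lambda> (\<lambda>_. {-1, 1})"

definition ham :: "('d \<Rightarrow> int) set \<Rightarrow> (('d \<Rightarrow> int) set \<Rightarrow> real) \<Rightarrow> (('d \<Rightarrow> int) \<Rightarrow> real) \<Rightarrow> real" where
  "ham \<Lambda> J \<sigma> = - (\<Sum>X\<in>Pow \<Lambda>. J X * sigmaX \<sigma> X)"

definition ncov :: "(('d \<Rightarrow> int) set \<Rightarrow> real) \<Rightarrow> ('d \<Rightarrow> int) set \<Rightarrow> (('d \<Rightarrow> int) \<Rightarrow> real) \<Rightarrow> (('d \<Rightarrow> int) \<Rightarrow> real) \<Rightarrow> real" where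
  "ncov Delta2 \<Lambda> \<sigma> \<tau> = (\<Sum>X\<in>Pow \<Lambda>. Delta2 X * sigmaX \<sigma> X * sigmaX \<tau> X) / real (card \<Lambda>)"

definition thermo_stable :: "(('d::finite \<Rightarrow> int) set \<Rightarrow> real) \<Rightarrow> bool" where
  "thermo_stable Delta2 \<longleftrightarrow> (\<exists>cbar. \<forall>\<Lambda>. box \<Lambda> \<longrightarrow> (\<Sum>X\<in>Pow \<Lambda>. Delta2 X) / real (card \<Lambda>) \<le> cbar)"

definition partition_fn :: "('d \<Rightarrow> int) set \<Rightarrow> (('d \<Rightarrow> int) set \<Rightarrow> real) \<Rightarrow> real \<Rightarrow> real" where
  "partition_fn \<Lambda> J \<beta> = (\<Sum>\<sigma>\<in>configs \<Lambda>. exp (- \<beta> * ham \<Lambda> J \<sigma>))"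

definition gibbs :: "nat \<Rightarrow> ('d \<Rightarrow> int) set \<Rightarrow> (('d \<Rightarrow> int) set \<Rightarrow> real) \<Rightarrow> real
     \<Rightarrow> ((nat \<Rightarrow> ('d \<Rightarrow> int) \<Rightarrow> real) \<Rightarrow> real) \<Rightarrow> real" where
  "gibbs n \<Lambda> J \<beta> f =
     (\<Sum>s\<in>PiE {1..n} (\<lambda>_. configs \<Lambda>). f s * exp (- \<beta> * (\<Sum>i=1..n. ham \<Lambda> J (s i))))
       / partition_fn \<Lambda> J \<beta> ^ n"

definition std_gauss :: "real measure" where
  "std_gauss = density lborel std_normal_density"

text \<open>Av: expectation over independent centred Gaussians J_X (X subset of Lambda) with
  variance Delta2 X, realised as J_X = sqrt(Delta2 X) * g_X with g_X i.i.d. standard normal.\<close>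
definition Av :: "(('d \<Rightarrow> int) set \<Rightarrow> real) \<Rightarrow> ('d \<Rightarrow> int) set \<Rightarrow> ((('d \<Rightarrow> int) set \<Rightarrow> real) \<Rightarrow> real) \<Rightarrow> real" where
  "Av Delta2 \<Lambda> F = integral\<^sup>L (PiM (Pow \<Lambda>) (\<lambda>_. std_gauss)) (\<lambda>g. F (\<lambda>X. sqrt (Delta2 X) * g X))"

definition quenched :: "(('d \<Rightarrow> int) set \<Rightarrow> real) \<Rightarrow> ('d \<Rightarrow> int) set \<Rightarrow> real \<Rightarrow> nat
     \<Rightarrow> ((nat \<Rightarrow> ('d \<Rightarrow> int) \<Rightarrow> real) \<Rightarrow> real) \<Rightarrow> real" where
  "quenched Delta2 \<Lambda> \<beta> n f = Av Delta2 \<Lambda> (\<lambda>J. gibbs n \<Lambda> J \<beta> f)"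

definition ovl :: "(('d \<Rightarrow> int) set \<Rightarrow> real) \<Rightarrow> ('d \<Rightarrow> int) set \<Rightarrow> (nat \<Rightarrow> ('d \<Rightarrow> int) \<Rightarrow> real) \<Rightarrow> nat \<Rightarrow> nat \<Rightarrow> real" where
  "ovl Delta2 \<Lambda> s k l = ncov Delta2 \<Lambda> (s k) (s l)"

definition ovm :: "(('d \<Rightarrow> int) set \<Rightarrow> real) \<Rightarrow> ('d \<Rightarrow> int) set \<Rightarrow> nat \<Rightarrow> (nat \<Rightarrow> ('d \<Rightarrow> int) \<Rightarrow> real) \<Rightarrow> nat \<Rightarrow> nat \<Rightarrow> real" where
  "ovm Delta2 \<Lambda> R s = (\<lambda>i j. if i \<in> {1..R} \<and> j \<in> {1..R} then ncov Delta2 \<Lambda> (s i) (s j) else 0)"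

text \<open>C^k regularity of a function of an R x R real matrix (matrices stored as nat => nat => real,
  entries (i,j) with i,j in 1..R; continuity w.r.t. the product topology): all partial derivatives
  up to order k exist and are continuous.\<close>
fun Ck :: "nat \<Rightarrow> nat \<Rightarrow> ((nat \<Rightarrow> nat \<Rightarrow> real) \<Rightarrow> real) \<Rightarrow> bool" where
  "Ck R 0 F = continuous_on UNIV F"
| "Ck R (Suc n) F = (continuous_on UNIV F \<and>
     (\<forall>i\<in>{1..R}. \<forall>j\<in>{1..R}. \<exists>D.
        (\<forall>M. ((\<lambda>t. F (M(i := (M i)(j := M i j + t)))) has_real_derivative D M) (at 0)) \<and> Ck R n D))"

definition observable :: "nat \<Rightarrow> ((nat \<Rightarrow> nat \<Rightarrow> real) \<Rightarrow> real) \<Rightarrow> bool" where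
  "observable R G \<longleftrightarrow>
     (\<forall>M. \<bar>G M\<bar> \<le> 1) \<and>
     (\<forall>M M'. (\<forall>i\<in>{1..R}. \<forall>j\<in>{1..R}. M i j = M' i j) \<longrightarrow> G M = G M') \<and>
     (\<forall>k. Ck R k G)"

end

theory Submission
  imports Defs
begin

text \<open>
  Both statements come from Gaussian integration by parts. With \<open>N\<close> the volume, the integrand of the
  first one is exactly \<open>2/N\<close> times the derivative of the quenched average of \<open>G\<close> with respect to
  the square of the inverse temperature, so its integral is at most \<open>4/N\<close>.

  The integrand of the second one is \<open>1/(\<beta> N)\<close> times the disorder covariance of the Gibbs averages of
  \<open>G\<close> and \<open>-H\<close>, hence at most \<open>1/(\<beta> N)\<close> times the mean absolute deviation of the Gibbs average of
  \<open>-H\<close>, which is the derivative of the log-partition function. The log-partition function is Lipschitz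
  in each coupling, so its variance is \<open>O(N)\<close>; since it is convex in \<open>\<beta>\<close>, its
  derivative is controlled by difference quotients with step \<open>\<delta>\<close>, and after integration over \<open>\<beta>\<close> the
  normalised deviation is \<open>O(1/(\<delta> sqrt N) + \<delta>)\<close>.
\<close>

section \<open>Replicated Gibbs averages\<close>

text \<open>Integration by parts turns an energy into overlaps, among them the overlap of a replica
  with itself. Every nonempty product of spins squares to 1, so this self-overlap is a constant
  \<open>c0\<close>, and it must cancel: in the first identity between the \<open>R\<close> replicas
  of \<open>G\<close> and the extra replica that stems from the normalisation, in the second between
  the mean of the product and the product of the means. The integration variable is the square of
  \<beta> because its differential \<open>2 \<beta> d\<beta>\<close> absorbs the factor \<beta> that
  every integration by parts leaves behind. The obstacle in the second identity is that the second
  difference of the mean log-partition function with step \<delta> is only known to be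
  O(\<open>N \<delta>\<close>) at a fixed \<beta>, which does not become small after division by
  \<open>N \<delta>\<close>. Its integral over \<beta> is O(\<open>N \<delta>\<^sup>2\<close>). The
  step is fixed before the volume grows.\<close>

definition gibbs_avg :: "'s set \<Rightarrow> nat \<Rightarrow> ('s \<Rightarrow> real) \<Rightarrow> ((nat \<Rightarrow> 's) \<Rightarrow> real) \<Rightarrow> real" where
  "gibbs_avg S n u f =
     (\<Sum>s\<in>PiE {1..n} (\<lambda>_. S). f s * exp (\<Sum>i=1..n. u (s i))) / (\<Sum>\<sigma>\<in>S. exp (u \<sigma>)) ^ n"

definition gibbs_mean :: "'s set \<Rightarrow> ('s \<Rightarrow> real) \<Rightarrow> ('s \<Rightarrow> real) \<Rightarrow> real" where
  "gibbs_mean S u h = (\<Sum>\<sigma>\<in>S. h \<sigma> * exp (u \<sigma>)) / (\<Sum>\<sigma>\<in>S. exp (u \<sigma>))"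

lemma sum_PiE_Suc:
  fixes F :: "(nat \<Rightarrow> 's) \<Rightarrow> real"
  assumes "finite S"
  shows "(\<Sum>s\<in>PiE {1..Suc n} (\<lambda>_. S). F s) = (\<Sum>s\<in>PiE {1..n} (\<lambda>_. S). \<Sum>\<sigma>\<in>S. F (s(Suc n := \<sigma>)))"
proof -
  have *: "{1..Suc n} = insert (Suc n) {1..n}"
    by auto
  have "(\<Sum>s\<in>PiE {1..Suc n} (\<lambda>_. S). F s) = (\<Sum>(\<sigma>, s)\<in>S \<times> PiE {1..n} (\<lambda>_. S). F (s(Suc n := \<sigma>)))"
    unfolding * PiE_insert_eq using inj_combinator [of "Suc n" "{1..n}" "\<lambda>_. S"]
    by (subst sum.reindex) (auto simp: case_prod_unfold)
  also have "\<dots> = (\<Sum>\<sigma>\<in>S. \<Sum>s\<in>PiE {1..n} (\<lambda>_. S). F (s(Suc n := \<sigma>)))"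
    by (rule sum.cartesian_product [symmetric])
  also have "\<dots> = (\<Sum>s\<in>PiE {1..n} (\<lambda>_. S). \<Sum>\<sigma>\<in>S. F (s(Suc n := \<sigma>)))"
    by (rule sum.swap)
  finally show ?thesis .
qed

lemma partition_sum_pos:
  fixes u :: "'s \<Rightarrow> real"
  assumes "finite S" "S \<noteq> {}"
  shows "0 < (\<Sum>\<sigma>\<in>S. exp (u \<sigma>))"
  using assms by (intro sum_pos) auto

text \<open>Replicas are independent under the product Gibbs measure, and \<open>f\<close> ignores
  replica \<open>Suc n\<close>. Read from right to left, this merges a product of Gibbs averages
  into one average over an additional replica.\<close>

lemma gibbs_avg_Suc_mult:
  assumes "finite S" and f: "\<And>s x. f (s(Suc n := x)) = f s"
  shows "gibbs_avg S (Suc n) u (\<lambda>s. f s * h (s (Suc n))) = gibbs_avg S n u f * gibbs_mean S u h"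
proof -
  have "(\<Sum>s\<in>PiE {1..Suc n} (\<lambda>_. S). f s * h (s (Suc n)) * exp (\<Sum>i=1..Suc n. u (s i)))
      = (\<Sum>s\<in>PiE {1..n} (\<lambda>_. S). \<Sum>\<sigma>\<in>S. (f s * exp (\<Sum>i=1..n. u (s i))) * (h \<sigma> * exp (u \<sigma>)))"
    unfolding sum_PiE_Suc [OF assms(1)]
    by (intro sum.cong refl) (simp add: f exp_add)
  then show ?thesis
    by (simp add: gibbs_avg_def gibbs_mean_def sum_product)
qed

lemma gibbs_mean_const:
  assumes "finite S" "S \<noteq> {}"
  shows "gibbs_mean S u (\<lambda>_. c) = c"
  using partition_sum_pos [OF assms, of u]
  by (simp add: gibbs_mean_def flip: sum_distrib_left)

lemma gibbs_avg_Suc: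
  assumes "finite S" "S \<noteq> {}" "\<And>s x. f (s(Suc n := x)) = f s"
  shows "gibbs_avg S (Suc n) u f = gibbs_avg S n u f"
  using gibbs_avg_Suc_mult [of S f n u "\<lambda>_. 1"] gibbs_mean_const [of S u 1] assms by simp

lemma gibbs_avg_1:
  assumes "finite S"
  shows "gibbs_avg S 1 u (\<lambda>s. h (s 1)) = gibbs_mean S u h"
  using gibbs_avg_Suc_mult [of S "\<lambda>_. 1" 0 u h] assms by (simp add: gibbs_avg_def)

lemma gibbs_avg_cong:
  assumes "\<And>s. s \<in> PiE {1..n} (\<lambda>_. S) \<Longrightarrow> f s = f' s"
  shows "gibbs_avg S n u f = gibbs_avg S n u f'"
  using assms by (simp add: gibbs_avg_def)

lemma gibbs_avg_add: "gibbs_avg S n u (\<lambda>s. f s + f' s) = gibbs_avg S n u f + gibbs_avg S n u f'"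
  by (simp add: gibbs_avg_def sum.distrib add_divide_distrib distrib_right)

lemma gibbs_avg_diff: "gibbs_avg S n u (\<lambda>s. f s - f' s) = gibbs_avg S n u f - gibbs_avg S n u f'"
  by (simp add: gibbs_avg_def sum_subtractf diff_divide_distrib left_diff_distrib)

lemma gibbs_avg_cmult: "gibbs_avg S n u (\<lambda>s. c * f s) = c * gibbs_avg S n u f"
  by (simp add: gibbs_avg_def sum_distrib_left mult.assoc)

lemma gibbs_avg_sum: "gibbs_avg S n u (\<lambda>s. \<Sum>j\<in>A. f j s) = (\<Sum>j\<in>A. gibbs_avg S n u (f j))"
  by (simp add: gibbs_avg_def sum_distrib_right sum_divide_distrib sum.swap [of _ A])

lemma gibbs_avg_const:
  assumes "finite S" "S \<noteq> {}"
  shows "gibbs_avg S n u (\<lambda>_. c) = c"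
proof (induction n)
  case 0
  then show ?case by (simp add: gibbs_avg_def)
next
  case (Suc n)
  then show ?case using gibbs_avg_Suc [of S "\<lambda>_. c" n u] assms by simp
qed

lemma gibbs_avg_abs_le:
  assumes "finite S" "S \<noteq> {}" "\<And>s. s \<in> PiE {1..n} (\<lambda>_. S) \<Longrightarrow> \<bar>f s\<bar> \<le> B"
  shows "\<bar>gibbs_avg S n u f\<bar> \<le> B"
proof -
  have Z: "0 < (\<Sum>\<sigma>\<in>S. exp (u \<sigma>)) ^ n"
    using partition_sum_pos [OF assms(1,2)] by simp
  have "\<bar>gibbs_avg S n u f\<bar> \<le> gibbs_avg S n u (\<lambda>_. B)"
    unfolding gibbs_avg_def using Z
    by (simp add: divide_right_mono)
       (intro divide_right_mono order.trans [OF sum_abs] sum_mono,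
        auto simp: abs_mult assms(3))
  then show ?thesis by (simp add: gibbs_avg_const assms(1,2))
qed

lemma gibbs_mean_abs_le:
  assumes "finite S" "S \<noteq> {}" "\<And>\<sigma>. \<sigma> \<in> S \<Longrightarrow> \<bar>h \<sigma>\<bar> \<le> B"
  shows "\<bar>gibbs_mean S u h\<bar> \<le> B"
  unfolding gibbs_avg_1 [OF assms(1), symmetric]
  by (rule gibbs_avg_abs_le [OF assms(1,2)]) (auto intro: assms(3))

text \<open>With the normalisation moved into the exponent the average is a finite sum of
  exponentials, which is differentiated without a quotient rule.\<close>

lemma gibbs_avg_exp_ln:
  assumes "finite S" "S \<noteq> {}"
  shows "gibbs_avg S n u f =
    (\<Sum>s\<in>PiE {1..n} (\<lambda>_. S). f s * exp ((\<Sum>i=1..n. u (s i)) - real n * ln (\<Sum>\<sigma>\<in>S. exp (u \<sigma>))))"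
  using partition_sum_pos [OF assms, of u]
  by (simp add: gibbs_avg_def exp_diff exp_of_nat_mult sum_divide_distrib)

lemma isCont_gibbs_avg:
  fixes u :: "real \<Rightarrow> 's \<Rightarrow> real"
  assumes "finite S" "S \<noteq> {}" "\<And>\<sigma>. isCont (\<lambda>x. u x \<sigma>) x"
  shows "isCont (\<lambda>x. gibbs_avg S n (u x) f) x"
  unfolding gibbs_avg_def using partition_sum_pos [OF assms(1,2), of "u x"]
  by (intro continuous_intros assms) simp

text \<open>Differentiating the n-th power of the partition sum produces \<open>n\<close> times a
  product of two averages; the extra replica turns this product into one average.\<close>

lemma gibbs_avg_extra_replica:
  assumes S: "finite S" "S \<noteq> {}" and f: "\<And>s x. f (s(Suc n := x)) = f s"
  shows "gibbs_avg S (Suc n) u (\<lambda>s. f s * ((\<Sum>k=1..n. v (s k)) - real n * v (s (Suc n)))) =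
    gibbs_avg S n u (\<lambda>s. f s * (\<Sum>k=1..n. v (s k))) - real n * gibbs_avg S n u f * gibbs_mean S u v"
proof -
  have "gibbs_avg S (Suc n) u (\<lambda>s. f s * ((\<Sum>k=1..n. v (s k)) - real n * v (s (Suc n))))
    = gibbs_avg S (Suc n) u (\<lambda>s. f s * (\<Sum>k=1..n. v (s k)))
      - real n * gibbs_avg S (Suc n) u (\<lambda>s. f s * v (s (Suc n)))"
    by (simp add: right_diff_distrib mult.left_commute gibbs_avg_diff gibbs_avg_cmult)
  also have "gibbs_avg S (Suc n) u (\<lambda>s. f s * (\<Sum>k=1..n. v (s k)))
      = gibbs_avg S n u (\<lambda>s. f s * (\<Sum>k=1..n. v (s k)))"
    by (rule gibbs_avg_Suc [OF S]) (simp add: f)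
  also have "gibbs_avg S (Suc n) u (\<lambda>s. f s * v (s (Suc n))) = gibbs_avg S n u f * gibbs_mean S u v"
    by (rule gibbs_avg_Suc_mult [OF S(1) f])
  finally show ?thesis by simp
qed

text \<open>The parameter \<open>x\<close> is abstract so that one formula serves for the derivative
  in \<beta>, where \<open>u'\<close> is the energy, and for the derivative in a single coupling,
  where \<open>u'\<close> is \<beta> times its coefficient.\<close>

lemma has_real_derivative_gibbs_avg:
  fixes u :: "real \<Rightarrow> 's \<Rightarrow> real"
  assumes S: "finite S" "S \<noteq> {}"
    and u: "\<And>\<sigma>. ((\<lambda>x. u x \<sigma>) has_real_derivative u' \<sigma>) (at x)"
    and f: "\<And>s x. f (s(Suc n := x)) = f s"
  shows "((\<lambda>x. gibbs_avg S n (u x) f) has_real_derivative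
      gibbs_avg S (Suc n) (u x) (\<lambda>s. f s * ((\<Sum>k=1..n. u' (s k)) - real n * u' (s (Suc n))))) (at x)"
proof -
  let ?Z = "\<Sum>\<sigma>\<in>S. exp (u x \<sigma>)"
  have lnZ: "((\<lambda>x. ln (\<Sum>\<sigma>\<in>S. exp (u x \<sigma>))) has_real_derivative gibbs_mean S (u x) u') (at x)"
    unfolding gibbs_mean_def
    by (rule derivative_eq_intros u refl partition_sum_pos [OF S])+ (simp add: mult.commute)
  have "((\<lambda>x. gibbs_avg S n (u x) f) has_real_derivative
     (\<Sum>s\<in>PiE {1..n} (\<lambda>_. S). f s * (exp ((\<Sum>i=1..n. u x (s i)) - real n * ln ?Z)
        * ((\<Sum>i=1..n. u' (s i)) - real n * gibbs_mean S (u x) u')))) (at x)"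
    unfolding gibbs_avg_exp_ln [OF S]
    by (rule lnZ derivative_eq_intros u refl)+ (simp add: ac_simps)
  moreover have "(\<Sum>s\<in>A. f s * (e s * (d s - k * m))) = (\<Sum>s\<in>A. f s * d s * e s) - k * (\<Sum>s\<in>A. f s * e s) * m"
    for A and e d :: "(nat \<Rightarrow> 's) \<Rightarrow> real" and k m
    by (simp add: algebra_simps sum_subtractf sum_distrib_left)
  ultimately show ?thesis
    by (subst gibbs_avg_extra_replica [OF S f]) (simp add: gibbs_avg_exp_ln [OF S])
qed

text \<open>The tangent-line form of the convexity of the log-partition function.\<close>

lemma ln_partition_sum_ge:
  fixes u h :: "'s \<Rightarrow> real"
  assumes S: "finite S" "S \<noteq> {}"
  shows "ln (\<Sum>\<sigma>\<in>S. exp (u \<sigma>)) + gibbs_mean S u h \<le> ln (\<Sum>\<sigma>\<in>S. exp (u \<sigma> + h \<sigma>))"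
proof -
  define m where "m = gibbs_mean S u h"
  let ?Z = "\<Sum>\<sigma>\<in>S. exp (u \<sigma>)"
  have Z: "0 < ?Z" by (rule partition_sum_pos [OF S])
  have "(\<Sum>\<sigma>\<in>S. h \<sigma> * exp (u \<sigma>)) = m * ?Z"
    using Z by (simp add: m_def gibbs_mean_def)
  \<comment> \<open>Centring \<open>h\<close> at its Gibbs mean adds terms of total weight zero, so
    that \<open>1 + x \<le> exp x\<close> can be applied termwise without loss at first
    order.\<close>
  then have "?Z = (\<Sum>\<sigma>\<in>S. exp (u \<sigma>) * (1 + (h \<sigma> - m)))"
    by (simp add: algebra_simps sum.distrib sum_subtractf sum_distrib_left)
  also have "\<dots> \<le> (\<Sum>\<sigma>\<in>S. exp (u \<sigma>) * exp (h \<sigma> - m))"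
    by (intro sum_mono mult_left_mono exp_ge_add_one_self) auto
  also have "\<dots> = exp (- m) * (\<Sum>\<sigma>\<in>S. exp (u \<sigma> + h \<sigma>))"
    by (simp add: sum_distrib_left exp_add exp_diff exp_minus field_simps)
  finally have "exp m * ?Z \<le> (\<Sum>\<sigma>\<in>S. exp (u \<sigma> + h \<sigma>))"
    by (simp add: exp_minus field_simps)
  then have "ln (exp m * ?Z) \<le> ln (\<Sum>\<sigma>\<in>S. exp (u \<sigma> + h \<sigma>))"
    using Z by (subst ln_le_cancel_iff) (auto intro: partition_sum_pos [OF S])
  then show ?thesis using Z by (simp add: ln_mult m_def)
qed

text \<open>The tangent-line bound with increment \<open>v - u\<close>, whose Gibbs mean is at least
  \<open>- d\<close>, gives one side; exchanging \<open>u\<close> and \<open>v\<close> gives the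
  other.\<close>

lemma ln_partition_sum_lipschitz:
  fixes u v :: "'s \<Rightarrow> real"
  assumes S: "finite S" "S \<noteq> {}" and d: "\<And>\<sigma>. \<sigma> \<in> S \<Longrightarrow> \<bar>u \<sigma> - v \<sigma>\<bar> \<le> d"
  shows "\<bar>ln (\<Sum>\<sigma>\<in>S. exp (u \<sigma>)) - ln (\<Sum>\<sigma>\<in>S. exp (v \<sigma>))\<bar> \<le> d"
proof -
  have "ln (\<Sum>\<sigma>\<in>S. exp (u \<sigma>)) \<le> ln (\<Sum>\<sigma>\<in>S. exp (v \<sigma>)) + d"
    if "\<And>\<sigma>. \<sigma> \<in> S \<Longrightarrow> \<bar>u \<sigma> - v \<sigma>\<bar> \<le> d" for u v :: "'s \<Rightarrow> real"
    using ln_partition_sum_ge [OF S, of u "\<lambda>\<sigma>. v \<sigma> - u \<sigma>"]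
      gibbs_mean_abs_le [OF S, of "\<lambda>\<sigma>. v \<sigma> - u \<sigma>" d u] that
    by (force simp: abs_minus_commute)
  from this [of u v] this [of v u] show ?thesis
    using d by (force simp: abs_minus_commute)
qed

section \<open>Gaussian product measures\<close>

lemma sets_std_gauss [measurable_cong, simp]: "sets std_gauss = sets borel"
  by (simp add: std_gauss_def)

lemma space_std_gauss [simp]: "space std_gauss = UNIV"
  by (simp add: std_gauss_def)

interpretation std_gauss: prob_space std_gauss
  unfolding std_gauss_def by (rule prob_space_normal_density) simp

interpretation gauss_prod: product_prob_space "\<lambda>_. std_gauss" I for I
  ..

lemma integrable_mult_bounded:
  fixes X F :: "'a \<Rightarrow> real"
  assumes "integrable M X" "F \<in> borel_measurable M" and B: "\<And>x. \<bar>F x\<bar> \<le> B"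
  shows "integrable M (\<lambda>x. X x * F x)"
proof (rule Bochner_Integration.integrable_bound [OF integrable_mult_left [OF assms(1), of B]])
  have "\<bar>X x\<bar> * \<bar>F x\<bar> \<le> \<bar>X x\<bar> * \<bar>B\<bar>" for x
    using B [of x] by (intro mult_left_mono) auto
  then show "AE x in M. norm (X x * F x) \<le> norm (X x * B)"
    by (simp add: abs_mult)
qed (use assms in measurable)

section \<open>Gaussian integration by parts in one and in several variables\<close>

lemma integrable_std_gauss_iff:
  fixes h :: "real \<Rightarrow> real"
  assumes "h \<in> borel_measurable borel"
  shows "integrable std_gauss h \<longleftrightarrow> integrable lborel (\<lambda>x. std_normal_density x * h x)"
  unfolding std_gauss_def using assms by (subst integrable_density) auto

lemma integral_std_gauss:
  fixes h :: "real \<Rightarrow> real"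
  assumes "h \<in> borel_measurable borel"
  shows "integral\<^sup>L std_gauss h = integral\<^sup>L lborel (\<lambda>x. std_normal_density x * h x)"
  unfolding std_gauss_def using assms by (subst integral_density) auto

lemma integrable_std_gauss_power: "integrable std_gauss (\<lambda>x. x ^ k)"
  by (simp add: integrable_std_gauss_iff integrable_std_normal_moment)

lemma integrable_std_gauss_id: "integrable std_gauss (\<lambda>x. x)"
  using integrable_std_gauss_power [of 1] by simp

lemma std_gauss_second_moment: "integral\<^sup>L std_gauss (\<lambda>x. x\<^sup>2) = 1"
  using integral_std_normal_moment_even [of 1] by (simp add: integral_std_gauss)

text \<open>These limits remove the boundary terms of the integration by parts, in which the other
  factor is bounded.\<close>

lemma std_normal_density_tendsto_0:
  "(std_normal_density \<longlongrightarrow> 0) at_top" "(std_normal_density \<longlongrightarrow> 0) at_bot"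
proof -
  have "filterlim (\<lambda>x::real. x * x / 2) at_top at_top"
    using filterlim_tendsto_pos_mult_at_top [of "\<lambda>_. 1/2" "1/2" at_top "\<lambda>x::real. x * x"]
    by (simp add: filterlim_at_top_mult_at_top filterlim_ident)
  then have "((\<lambda>x::real. exp (- (x * x / 2))) \<longlongrightarrow> 0) at_top"
    by (intro filterlim_compose [OF exp_at_bot] filterlim_compose [OF filterlim_uminus_at_bot_at_top])
  then have "((\<lambda>x. 1 / sqrt (2 * pi) * exp (- (x * x / 2))) \<longlongrightarrow> 1 / sqrt (2 * pi) * 0) at_top"
    by (rule tendsto_mult_left)
  then show *: "(std_normal_density \<longlongrightarrow> 0) at_top"
    by (simp add: std_normal_density_def [abs_def] power2_eq_square)
  show "(std_normal_density \<longlongrightarrow> 0) at_bot"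
    unfolding filterlim_at_bot_mirror using * by (simp add: std_normal_density_def [abs_def])
qed

lemma has_real_derivative_std_normal_density:
  "(std_normal_density has_real_derivative - x * std_normal_density x) (at x)"
  unfolding std_normal_density_def
  by (rule derivative_eq_intros refl | simp)+

text \<open>The product of the density with \<open>f\<close> vanishes at both ends, so its
  derivative has integral zero; that derivative is the difference of the two integrands because the
  density satisfies \<open>p' = - x p\<close>.\<close>

lemma std_gauss_integral_by_parts:
  fixes f f' :: "real \<Rightarrow> real"
  assumes deriv: "\<And>x. (f has_real_derivative f' x) (at x)" and cont: "\<And>x. isCont f' x"
    and B: "\<And>x. \<bar>f x\<bar> \<le> B" and B': "\<And>x. \<bar>f' x\<bar> \<le> B'"
  shows "integral\<^sup>L std_gauss (\<lambda>x. x * f x) = integral\<^sup>L std_gauss f'"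
proof -
  let ?p = std_normal_density
  have contf: "isCont f x" for x
    using deriv DERIV_isCont by blast
  have contp: "isCont ?p x" for x
    using has_real_derivative_std_normal_density DERIV_isCont by blast
  have [measurable]: "f \<in> borel_measurable borel" "f' \<in> borel_measurable borel"
    using contf cont by (auto intro!: borel_measurable_continuous_onI simp: continuous_on_eq_continuous_at)
  have int: "integrable std_gauss f'" "integrable std_gauss (\<lambda>x. x * f x)"
    using B' B
    by (auto intro!: std_gauss.integrable_const_bound [where B = B']
        integrable_mult_bounded [OF integrable_std_gauss_id])
  then have int': "integrable lborel (\<lambda>x. ?p x * f' x)" "integrable lborel (\<lambda>x. ?p x * (x * f x))"
    by (simp_all add: integrable_std_gauss_iff)
  have lim: "((\<lambda>x. ?p x * f x) \<longlongrightarrow> 0) F" if "(?p \<longlongrightarrow> 0) F" for F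
  proof (rule Lim_null_comparison)
    show "((\<lambda>x. ?p x * B) \<longlongrightarrow> 0) F"
      using tendsto_mult_right [OF that, of B] by simp
  qed (simp add: abs_mult mult_left_mono B)
  have "(LBINT x=-\<infinity>..\<infinity>. ?p x * f' x - ?p x * (x * f x)) = 0 - 0"
  proof (rule interval_integral_FTC_integrable [where F = "\<lambda>x. ?p x * f x"])
    show "((\<lambda>x. ?p x * f x) has_vector_derivative ?p x * f' x - ?p x * (x * f x)) (at x)" for x
      unfolding has_real_derivative_iff_has_vector_derivative [symmetric]
      by (rule derivative_eq_intros has_real_derivative_std_normal_density deriv refl)+
         (simp add: algebra_simps)
    show "isCont (\<lambda>x. ?p x * f' x - ?p x * (x * f x)) x" for x
      by (intro continuous_intros contp contf cont)
    show "set_integrable lborel (einterval (-\<infinity>) \<infinity>) (\<lambda>x. ?p x * f' x - ?p x * (x * f x))"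
      using int' by (simp add: set_integrable_def)
  qed (auto simp: ereal_tendsto_simps intro!: lim std_normal_density_tendsto_0)
  then have "integral\<^sup>L lborel (\<lambda>x. ?p x * f' x - ?p x * (x * f x)) = 0"
    by (simp add: interval_lebesgue_integral_def set_lebesgue_integral_def)
  then show ?thesis
    using int' by (simp add: integral_std_gauss)
qed

abbreviation gauss_PiM :: "'i set \<Rightarrow> ('i \<Rightarrow> real) measure" where
  "gauss_PiM I \<equiv> PiM I (\<lambda>_. std_gauss)"

lemma integrable_gauss_component:
  fixes h :: "real \<Rightarrow> real"
  assumes "integrable std_gauss h" "i \<in> I"
  shows "integrable (gauss_PiM I) (\<lambda>g. h (g i))"
proof -
  have "integrable (distr (gauss_PiM I) std_gauss (\<lambda>g. g i)) h"
    using assms by (simp add: gauss_prod.PiM_component)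
  then show ?thesis
    using assms by (subst (asm) integrable_distr_eq) auto
qed

text \<open>Fubini isolates coordinate \<open>i\<close>, and the one-dimensional formula is applied
  with the others frozen. The bounds uniform in \<open>g\<close> give the integrability that Fubini
  asks for.\<close>

lemma gauss_PiM_integral_by_parts:
  fixes F F' :: "('i \<Rightarrow> real) \<Rightarrow> real"
  assumes I: "finite I" "i \<in> I"
    and [measurable]: "F \<in> borel_measurable (gauss_PiM I)" "F' \<in> borel_measurable (gauss_PiM I)"
    and deriv: "\<And>g x. ((\<lambda>x. F (g(i := x))) has_real_derivative F' (g(i := x))) (at x)"
    and cont: "\<And>g x. isCont (\<lambda>x. F' (g(i := x))) x"
    and B: "\<And>g. \<bar>F g\<bar> \<le> B" and B': "\<And>g. \<bar>F' g\<bar> \<le> B'"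
  shows "integral\<^sup>L (gauss_PiM I) (\<lambda>g. g i * F g) = integral\<^sup>L (gauss_PiM I) F'"
proof -
  let ?J = "I - {i}"
  have I': "finite ?J" "i \<notin> ?J" "insert i ?J = I" using I by auto
  have int1: "integrable (gauss_PiM I) (\<lambda>g. g i * F g)"
    using integrable_gauss_component [OF integrable_std_gauss_id I(2)] assms(3) B
    by (rule integrable_mult_bounded)
  have int2: "integrable (gauss_PiM I) F'"
    using B' by (intro gauss_prod.P.integrable_const_bound [where B = B']) auto
  have "integral\<^sup>L (gauss_PiM I) (\<lambda>g. g i * F g)
      = (\<integral>g. (\<integral>x. x * F (g(i := x)) \<partial>std_gauss) \<partial>gauss_PiM ?J)"
    using gauss_prod.product_integral_insert [OF I'(1,2), of "\<lambda>g. g i * F g"] int1 I'(3) by simp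
  also have "\<dots> = (\<integral>g. (\<integral>x. F' (g(i := x)) \<partial>std_gauss) \<partial>gauss_PiM ?J)"
    using std_gauss_integral_by_parts [OF deriv cont B B'] by simp
  also have "\<dots> = integral\<^sup>L (gauss_PiM I) F'"
    using gauss_prod.product_integral_insert [OF I'(1,2), of F'] int2 I'(3) by simp
  finally show ?thesis .
qed

section \<open>Variance of Lipschitz functions of independent Gaussians\<close>

lemma measure_gauss_PiM_space [simp]: "measure (gauss_PiM I) (space (gauss_PiM I)) = 1"
  by (rule gauss_prod.P.prob_space)

text \<open>The variance is at most the second moment of \<open>h - h 0\<close>, since the mean
  minimises the expected squared distance, and the Lipschitz bound compares \<open>h x - h 0\<close>
  with \<open>L * x\<close>. Second moments are used instead of variances because they pass through
  Fubini directly.\<close>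

lemma std_gauss_lipschitz:
  fixes h :: "real \<Rightarrow> real"
  assumes L: "\<And>x y. \<bar>h x - h y\<bar> \<le> L * \<bar>x - y\<bar>"
  shows "integrable std_gauss h" "integrable std_gauss (\<lambda>x. (h x)\<^sup>2)"
    "integral\<^sup>L std_gauss (\<lambda>x. (h x)\<^sup>2) \<le> (integral\<^sup>L std_gauss h)\<^sup>2 + L\<^sup>2"
proof -
  define k where "k x = h x - h 0" for x
  have "0 \<le> L" using L [of 1 0] by simp
  then have "L-lipschitz_on UNIV h"
    using L by (intro lipschitz_onI) (auto simp: dist_real_def)
  then have [measurable]: "h \<in> borel_measurable borel"
    by (intro borel_measurable_continuous_onI lipschitz_on_continuous_on)
  then have [measurable]: "k \<in> borel_measurable borel"
    by (simp add: k_def [abs_def])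
  have k: "\<bar>k x\<bar> \<le> L * \<bar>x\<bar>" for x
    using L [of x 0] by (simp add: k_def)
  have k2: "(k x)\<^sup>2 \<le> L\<^sup>2 * x\<^sup>2" for x
    using power_mono [OF k, of x 2] by (simp add: power_mult_distrib)
  have int_k: "integrable std_gauss k"
    by (rule Bochner_Integration.integrable_bound
        [OF integrable_mult_right [OF integrable_std_gauss_id, of L]])
      (use k \<open>0 \<le> L\<close> in \<open>auto simp: abs_mult\<close>)
  have int_L: "integrable std_gauss (\<lambda>x. L\<^sup>2 * x\<^sup>2)"
    by (rule integrable_mult_right [OF integrable_std_gauss_power])
  have int_k2: "integrable std_gauss (\<lambda>x. (k x)\<^sup>2)"
    by (rule Bochner_Integration.integrable_bound [OF int_L]) (use k2 in auto)
  have h: "h = (\<lambda>x. k x + h 0)" by (simp add: k_def)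
  have h2: "(\<lambda>x. (h x)\<^sup>2) = (\<lambda>x. (k x)\<^sup>2 + 2 * h 0 * k x + (h 0)\<^sup>2)"
    by (simp add: k_def power2_eq_square algebra_simps)
  show "integrable std_gauss h"
    by (subst h) (use int_k in auto)
  show "integrable std_gauss (\<lambda>x. (h x)\<^sup>2)"
    unfolding h2 using int_k int_k2 by auto
  have int_h: "integral\<^sup>L std_gauss h = integral\<^sup>L std_gauss k + h 0"
    by (subst h) (use int_k std_gauss.prob_space in auto)
  have "integral\<^sup>L std_gauss (\<lambda>x. (h x)\<^sup>2)
      = integral\<^sup>L std_gauss (\<lambda>x. (k x)\<^sup>2) + 2 * h 0 * integral\<^sup>L std_gauss k + (h 0)\<^sup>2"
    unfolding h2 using int_k int_k2 std_gauss.prob_space by auto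
  also have "integral\<^sup>L std_gauss (\<lambda>x. (k x)\<^sup>2) \<le> integral\<^sup>L std_gauss (\<lambda>x. L\<^sup>2 * x\<^sup>2)"
    by (rule integral_mono [OF int_k2 int_L k2])
  also have "\<dots> = L\<^sup>2"
    by (simp add: std_gauss_second_moment)
  also have "L\<^sup>2 + 2 * h 0 * integral\<^sup>L std_gauss k + (h 0)\<^sup>2
      = (integral\<^sup>L std_gauss h)\<^sup>2 + L\<^sup>2 - (integral\<^sup>L std_gauss k)\<^sup>2"
    unfolding int_h by (simp add: power2_eq_square algebra_simps)
  also have "\<dots> \<le> (integral\<^sup>L std_gauss h)\<^sup>2 + L\<^sup>2"
    by simp
  finally show "integral\<^sup>L std_gauss (\<lambda>x. (h x)\<^sup>2) \<le> (integral\<^sup>L std_gauss h)\<^sup>2 + L\<^sup>2"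
    by simp
qed

lemma gauss_PiM_lipschitz_integrable:
  fixes F :: "('i \<Rightarrow> real) \<Rightarrow> real"
  assumes I: "finite I" and [measurable]: "F \<in> borel_measurable (gauss_PiM I)"
    and L: "\<And>g g'. \<bar>F g - F g'\<bar> \<le> (\<Sum>i\<in>I. L i * \<bar>g i - g' i\<bar>)"
  shows "integrable (gauss_PiM I) F" "integrable (gauss_PiM I) (\<lambda>g. (F g)\<^sup>2)"
proof -
  have int: "integrable (gauss_PiM I) (\<lambda>g. 2 * (F (\<lambda>_. 0))\<^sup>2 + 2 * ((\<Sum>i\<in>I. (L i)\<^sup>2) * (\<Sum>i\<in>I. (g i)\<^sup>2)))"
    by (intro Bochner_Integration.integrable_add integrable_mult_right Bochner_Integration.integrable_sum
        integrable_gauss_component [OF integrable_std_gauss_power]) auto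
  \<comment> \<open>Comparison with the value at 0, followed by Cauchy-Schwarz, dominates the square
    of \<open>F\<close> by an integrable sum of squared Gaussians.\<close>
  have "(F g)\<^sup>2 \<le> 2 * (F (\<lambda>_. 0))\<^sup>2 + 2 * ((\<Sum>i\<in>I. (L i)\<^sup>2) * (\<Sum>i\<in>I. (g i)\<^sup>2))" for g
  proof -
    have "(F g)\<^sup>2 \<le> 2 * (F (\<lambda>_. 0))\<^sup>2 + 2 * (F g - F (\<lambda>_. 0))\<^sup>2"
      using zero_le_power2 [of "F g - 2 * F (\<lambda>_. 0)"] by (simp add: power2_eq_square algebra_simps)
    also have "(F g - F (\<lambda>_. 0))\<^sup>2 \<le> (\<Sum>i\<in>I. L i * \<bar>g i\<bar>)\<^sup>2"
      using L [of g "\<lambda>_. 0"] by (intro abs_le_square_iff [THEN iffD1]) simp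
    also have "\<dots> \<le> (\<Sum>i\<in>I. (L i)\<^sup>2) * (\<Sum>i\<in>I. (g i)\<^sup>2)"
      using Cauchy_Schwarz_ineq_sum [of L "\<lambda>i. \<bar>g i\<bar>" I] by simp
    finally show ?thesis by simp
  qed
  then show F2: "integrable (gauss_PiM I) (\<lambda>g. (F g)\<^sup>2)"
    by (intro Bochner_Integration.integrable_bound [OF int]) (auto intro!: order.trans [OF _ abs_ge_self])
  show "integrable (gauss_PiM I) F"
    using assms(2) F2 by (rule gauss_prod.P.square_integrable_imp_integrable)
qed

text \<open>Efron-Stein: averaging out one coordinate preserves the Lipschitz constants of the others.\<close>

lemma gauss_PiM_lipschitz_variance:
  fixes F :: "('i \<Rightarrow> real) \<Rightarrow> real"
  assumes "finite I" "F \<in> borel_measurable (gauss_PiM I)"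
    and "\<And>g g'. \<bar>F g - F g'\<bar> \<le> (\<Sum>i\<in>I. L i * \<bar>g i - g' i\<bar>)"
  shows "integral\<^sup>L (gauss_PiM I) (\<lambda>g. (F g)\<^sup>2) \<le> (integral\<^sup>L (gauss_PiM I) F)\<^sup>2 + (\<Sum>i\<in>I. (L i)\<^sup>2)"
  using assms
proof (induction I arbitrary: F rule: finite_induct)
  case empty
  then have "F g = F (\<lambda>_. 0)" for g
    by simp
  then obtain c where "F = (\<lambda>_. c)" by blast
  then show ?case
    by simp
next
  case (insert i I)
  note [measurable] = insert.prems(1)
  have lip: "\<bar>F g - F g'\<bar> \<le> (\<Sum>j\<in>insert i I. L j * \<bar>g j - g' j\<bar>)" for g g'
    by (rule insert.prems(2))
  \<comment> \<open>The variance splits into the fluctuation in the new coordinate, at most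
    \<open>(L i)\<^sup>2\<close>, and the variance of the partial mean \<open>?m\<close>, to which
    the induction hypothesis applies.\<close>
  let ?m = "\<lambda>g. \<integral>x. F (g(i := x)) \<partial>std_gauss"
  have meas_m: "?m \<in> borel_measurable (gauss_PiM I)"
    by measurable
  have lip_i: "\<bar>F (g(i := x)) - F (g(i := y))\<bar> \<le> L i * \<bar>x - y\<bar>" for g x y
  proof -
    have "(\<Sum>j\<in>I. L j * \<bar>(g(i := x)) j - (g(i := y)) j\<bar>) = 0"
      using insert.hyps by (intro sum.neutral) auto
    then show ?thesis
      using lip [of "g(i := x)" "g(i := y)"] insert.hyps by simp
  qed
  have int1: "integrable std_gauss (\<lambda>x. F (g(i := x)))" for g
    by (rule std_gauss_lipschitz(1) [OF lip_i])
  have lip_m: "\<bar>?m g - ?m g'\<bar> \<le> (\<Sum>j\<in>I. L j * \<bar>g j - g' j\<bar>)" for g g'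
  proof -
    have "\<bar>F (g(i := x)) - F (g'(i := x))\<bar> \<le> (\<Sum>j\<in>I. L j * \<bar>g j - g' j\<bar>)" for x
    proof -
      have "(\<Sum>j\<in>I. L j * \<bar>(g(i := x)) j - (g'(i := x)) j\<bar>) = (\<Sum>j\<in>I. L j * \<bar>g j - g' j\<bar>)"
        using insert.hyps by (intro sum.cong) auto
      then show ?thesis
        using lip [of "g(i := x)" "g'(i := x)"] insert.hyps by simp
    qed
    then have "\<bar>\<integral>x. F (g(i := x)) - F (g'(i := x)) \<partial>std_gauss\<bar> \<le> (\<Sum>j\<in>I. L j * \<bar>g j - g' j\<bar>)"
      using int1
      by (intro order.trans [OF integral_abs_bound] std_gauss.integral_le_const) auto
    then show ?thesis
      using int1 by simp
  qed
  have int_m: "integrable (gauss_PiM I) (\<lambda>g. (?m g)\<^sup>2)"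
    by (rule gauss_PiM_lipschitz_integrable(2) [OF insert.hyps(1) meas_m lip_m])
  have le: "(\<integral>x. (F (g(i := x)))\<^sup>2 \<partial>std_gauss) \<le> (?m g)\<^sup>2 + (L i)\<^sup>2" for g
    by (rule std_gauss_lipschitz(3) [OF lip_i])
  have int_m': "integrable (gauss_PiM I) (\<lambda>g. (?m g)\<^sup>2 + (L i)\<^sup>2)"
    using int_m by simp
  have int_sq: "integrable (gauss_PiM I) (\<lambda>g. \<integral>x. (F (g(i := x)))\<^sup>2 \<partial>std_gauss)"
    by (rule Bochner_Integration.integrable_bound [OF int_m']) (use le in auto)
  have int: "integrable (gauss_PiM (insert i I)) F" "integrable (gauss_PiM (insert i I)) (\<lambda>g. (F g)\<^sup>2)"
    by (rule gauss_PiM_lipschitz_integrable [OF finite.insertI [OF insert.hyps(1)] insert.prems])+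
  have "integral\<^sup>L (gauss_PiM (insert i I)) (\<lambda>g. (F g)\<^sup>2)
      = (\<integral>g. (\<integral>x. (F (g(i := x)))\<^sup>2 \<partial>std_gauss) \<partial>gauss_PiM I)"
    by (rule gauss_prod.product_integral_insert [OF insert.hyps int(2)])
  also have "\<dots> \<le> (\<integral>g. (?m g)\<^sup>2 + (L i)\<^sup>2 \<partial>gauss_PiM I)"
    by (rule integral_mono [OF int_sq int_m' le])
  also have "\<dots> = (\<integral>g. (?m g)\<^sup>2 \<partial>gauss_PiM I) + (L i)\<^sup>2"
    using int_m by simp
  also have "(\<integral>g. (?m g)\<^sup>2 \<partial>gauss_PiM I) \<le> (\<integral>g. ?m g \<partial>gauss_PiM I)\<^sup>2 + (\<Sum>j\<in>I. (L j)\<^sup>2)"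
    by (rule insert.IH [OF meas_m lip_m])
  also have "(\<integral>g. ?m g \<partial>gauss_PiM I) = integral\<^sup>L (gauss_PiM (insert i I)) F"
    by (rule gauss_prod.product_integral_insert [OF insert.hyps int(1), symmetric])
  finally show ?case
    using insert.hyps by simp
qed

lemma gauss_PiM_lipschitz_mean_deviation:
  fixes F :: "('i \<Rightarrow> real) \<Rightarrow> real"
  assumes I: "finite I" and [measurable]: "F \<in> borel_measurable (gauss_PiM I)"
    and L: "\<And>g g'. \<bar>F g - F g'\<bar> \<le> (\<Sum>i\<in>I. L i * \<bar>g i - g' i\<bar>)"
  shows "(\<integral>g. \<bar>F g - integral\<^sup>L (gauss_PiM I) F\<bar> \<partial>gauss_PiM I) \<le> sqrt (\<Sum>i\<in>I. (L i)\<^sup>2)"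
proof -
  let ?P = "gauss_PiM I"
  define c where "c = integral\<^sup>L ?P F"
  define m where "m = (\<integral>g. \<bar>F g - c\<bar> \<partial>?P)"
  note int = gauss_PiM_lipschitz_integrable [OF assms]
  \<comment> \<open>Expanding this square shows that the squared mean deviation is at most the
    variance.\<close>
  have "0 \<le> (\<integral>g. (\<bar>F g - c\<bar> - m)\<^sup>2 \<partial>?P)"
    by simp
  also have "\<dots> = (\<integral>g. (F g)\<^sup>2 - 2 * c * F g + c\<^sup>2 - 2 * m * \<bar>F g - c\<bar> + m\<^sup>2 \<partial>?P)"
    by (rule Bochner_Integration.integral_cong) (auto simp: power2_diff algebra_simps)
  also have "\<dots> = integral\<^sup>L ?P (\<lambda>g. (F g)\<^sup>2) - c\<^sup>2 - m\<^sup>2"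
    using int
    by (simp add: flip: m_def c_def) (simp add: power2_eq_square)
  finally have "m\<^sup>2 \<le> (\<Sum>i\<in>I. (L i)\<^sup>2)"
    using gauss_PiM_lipschitz_variance [OF assms] by (simp add: c_def)
  then have "m \<le> sqrt (\<Sum>i\<in>I. (L i)\<^sup>2)"
    by (rule real_le_rsqrt)
  then show ?thesis by (simp add: m_def c_def)
qed

section \<open>Differentiation under the integral and second differences\<close>

text \<open>Dominated convergence along sequences: since \<open>B w\<close> bounds the derivative at
  every \<open>x\<close>, the mean value inequality makes it a bound for all difference
  quotients.\<close>

lemma has_real_derivative_integral:
  fixes f f' :: "real \<Rightarrow> 'a \<Rightarrow> real"
  assumes deriv: "\<And>x w. ((\<lambda>x. f x w) has_real_derivative f' x w) (at x)"
    and bound: "\<And>x w. \<bar>f' x w\<bar> \<le> B w" and B: "integrable M B"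
    and f: "\<And>x. integrable M (f x)" and f': "f' x \<in> borel_measurable M"
  shows "((\<lambda>x. integral\<^sup>L M (f x)) has_real_derivative integral\<^sup>L M (f' x)) (at x)"
  unfolding has_field_derivative_iff tendsto_at_iff_sequentially
proof (intro allI impI)
  fix X :: "nat \<Rightarrow> real"
  assume X: "\<forall>i. X i \<in> UNIV - {x}" "X \<longlonglongrightarrow> x"
  have "(\<lambda>i. integral\<^sup>L M (\<lambda>w. (f (X i) w - f x w) / (X i - x))) \<longlonglongrightarrow> integral\<^sup>L M (f' x)"
  proof (rule integral_dominated_convergence [OF f' _ B])
    show "AE w in M. (\<lambda>i. (f (X i) w - f x w) / (X i - x)) \<longlonglongrightarrow> f' x w"
    proof (rule AE_I2)
      fix w
      have "((\<lambda>y. (f y w - f x w) / (y - x)) \<longlongrightarrow> f' x w) (at x)"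
        using deriv [of w x] by (simp add: has_field_derivative_iff)
      then show "(\<lambda>i. (f (X i) w - f x w) / (X i - x)) \<longlonglongrightarrow> f' x w"
        using X unfolding tendsto_at_iff_sequentially comp_def by blast
    qed
    show "AE w in M. norm ((f (X i) w - f x w) / (X i - x)) \<le> B w" for i
    proof (rule AE_I2)
      fix w
      have "\<bar>f (X i) w - f x w\<bar> \<le> B w * \<bar>X i - x\<bar>"
        using field_differentiable_bound [of UNIV "\<lambda>y. f y w" "\<lambda>y. f' y w" "B w" "X i" x] deriv bound
        by simp
      then show "norm ((f (X i) w - f x w) / (X i - x)) \<le> B w"
        using X by (simp add: abs_divide divide_le_eq)
    qed
  qed (use f in auto)
  then show "((\<lambda>y. (integral\<^sup>L M (f y) - integral\<^sup>L M (f x)) / (y - x)) \<circ> X) \<longlonglongrightarrow> integral\<^sup>L M (f' x)"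
    using f by (simp add: comp_def)
qed

text \<open>The integral is the increment over the interval of the second difference of a primitive
  of \<open>p\<close>, which gains a power of \<delta> over that of \<open>p\<close> itself. The
  interval is enlarged by 1 to make room for the shifts.\<close>

lemma second_difference_integral_le:
  fixes p :: "real \<Rightarrow> real"
  assumes lip: "\<And>x y. x \<in> {a - 1..b + 1} \<Longrightarrow> y \<in> {a - 1..b + 1} \<Longrightarrow> \<bar>p x - p y\<bar> \<le> K * \<bar>x - y\<bar>"
    and ab: "a \<le> b" and \<delta>: "0 < \<delta>" "\<delta> < 1"
  shows "continuous_on {a..b} (\<lambda>x. p (x + \<delta>) - 2 * p x + p (x - \<delta>))" (is ?cont)
    and "integral {a..b} (\<lambda>x. p (x + \<delta>) - 2 * p x + p (x - \<delta>)) \<le> 4 * K * \<delta>\<^sup>2" (is ?le)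
proof -
  have "0 \<le> K * \<bar>a - (a + \<delta>)\<bar>"
    using ab \<delta> by (intro order.trans [OF abs_ge_zero lip]) auto
  then have K: "0 \<le> K"
    using \<delta> by (simp add: zero_le_mult_iff)
  have "K-lipschitz_on {a - 1..b + 1} p"
    using lip K by (intro lipschitz_onI) (auto simp: dist_real_def)
  then have cont: "continuous_on {a - 1..b + 1} p"
    by (rule lipschitz_on_continuous_on)
  then show ?cont
    using \<delta> by (intro continuous_intros continuous_on_compose2 [OF cont]) auto
  obtain q where q: "\<And>x. x \<in> {a - 1..b + 1} \<Longrightarrow> (q has_vector_derivative p x) (at x within {a - 1..b + 1})"
    using antiderivative_continuous [OF cont] by blast
  have dq: "(q has_real_derivative p x) (at x)" if "a - 1 < x" "x < b + 1" for x
    using q [of x] that at_within_Icc_at [of "a - 1" x "b + 1"]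
    by (simp add: has_real_derivative_iff_has_vector_derivative)
  define H where "H x = q (x + \<delta>) - 2 * q x + q (x - \<delta>)" for x
  have "(H has_real_derivative p (x + \<delta>) - 2 * p x + p (x - \<delta>)) (at x)" if "x \<in> {a..b}" for x
  proof -
    have "((\<lambda>x. q (x + \<delta>)) has_real_derivative p (x + \<delta>)) (at x)"
      "((\<lambda>x. q (x - \<delta>)) has_real_derivative p (x - \<delta>)) (at x)"
      using dq [of "x + \<delta>"] dq [of "x - \<delta>"] that \<delta>
        DERIV_shift [of q _ x \<delta>] DERIV_shift [of q _ x "- \<delta>"] by auto
    then show ?thesis
      unfolding H_def [abs_def] using that \<delta> by (auto intro!: derivative_eq_intros dq)
  qed
  then have "((\<lambda>x. p (x + \<delta>) - 2 * p x + p (x - \<delta>)) has_integral H b - H a) {a..b}"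
    using ab by (intro fundamental_theorem_of_calculus)
      (auto simp: has_real_derivative_iff_has_vector_derivative [symmetric] intro: DERIV_subset)
  then have int: "integral {a..b} (\<lambda>x. p (x + \<delta>) - 2 * p x + p (x - \<delta>)) = H b - H a"
    by (rule integral_unique)
  have "\<bar>H x\<bar> \<le> 2 * K * \<delta>\<^sup>2" if x: "x \<in> {a..b}" for x
  proof -
    \<comment> \<open>The mean value theorem on each side of \<open>x\<close> gives
      \<open>H x = \<delta> * (p y - p z)\<close> with \<open>y\<close> and \<open>z\<close> less
      than \<open>2 * \<delta>\<close> apart. Each endpoint thus costs
      \<open>2 * K * \<delta>\<^sup>2\<close>, whence the constant 4.\<close>
    obtain y where y: "x < y" "y < x + \<delta>" "q (x + \<delta>) - q x = (x + \<delta> - x) * p y"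
      using MVT2 [of x "x + \<delta>" q p] dq x \<delta> by auto
    obtain z where z: "x - \<delta> < z" "z < x" "q x - q (x - \<delta>) = (x - (x - \<delta>)) * p z"
      using MVT2 [of "x - \<delta>" x q p] dq x \<delta> by auto
    have "H x = \<delta> * (p y - p z)"
      using y z by (simp add: H_def algebra_simps)
    also have "\<bar>\<dots>\<bar> = \<delta> * \<bar>p y - p z\<bar>"
      using \<delta> by (simp add: abs_mult)
    also have "\<bar>p y - p z\<bar> \<le> K * \<bar>y - z\<bar>"
      using x y z \<delta> by (intro lip) auto
    also have "K * \<bar>y - z\<bar> \<le> K * (2 * \<delta>)"
      using x y z \<delta> K by (intro mult_left_mono) auto
    finally show ?thesis
      using \<delta> by (simp add: power2_eq_square algebra_simps)
  qed
  from this [of a] this [of b] show ?le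
    unfolding int using ab by (simp add: abs_le_iff)
qed

section \<open>Gibbs states with Gaussian disorder\<close>

text \<open>The couplings \<open>g i\<close> are standard Gaussians; their standard deviations are
  absorbed in the coefficients. For the spin glass the indices are the subsets of \<Lambda> and
  \<open>a X \<sigma>\<close> is \<open>sqrt (Delta2 X) * sigmaX \<sigma> X\<close>.\<close>

locale gaussian_gibbs =
  fixes I :: "'i set" and S :: "'s set" and a :: "'i \<Rightarrow> 's \<Rightarrow> real"
  assumes finite_I: "finite I" and finite_S: "finite S" and S_nonempty: "S \<noteq> {}"
begin

text \<open>This is minus the Hamiltonian, so the Gibbs weight is
  \<open>exp (\<beta> * energy g \<sigma>)\<close>.\<close>

definition energy :: "('i \<Rightarrow> real) \<Rightarrow> 's \<Rightarrow> real" where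
  "energy g \<sigma> = (\<Sum>i\<in>I. a i \<sigma> * g i)"

text \<open>The covariance of the Gaussian field \<open>energy\<close>, not divided by the
  volume.\<close>

definition cov :: "'s \<Rightarrow> 's \<Rightarrow> real" where
  "cov \<sigma> \<tau> = (\<Sum>i\<in>I. a i \<sigma> * a i \<tau>)"

definition replica_avg :: "nat \<Rightarrow> real \<Rightarrow> ('i \<Rightarrow> real) \<Rightarrow> ((nat \<Rightarrow> 's) \<Rightarrow> real) \<Rightarrow> real" where
  "replica_avg n \<beta> g f = gibbs_avg S n (\<lambda>\<sigma>. \<beta> * energy g \<sigma>) f"

definition mean_energy :: "real \<Rightarrow> ('i \<Rightarrow> real) \<Rightarrow> real" where
  "mean_energy \<beta> g = gibbs_mean S (\<lambda>\<sigma>. \<beta> * energy g \<sigma>) (energy g)"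

definition quenched_avg :: "nat \<Rightarrow> real \<Rightarrow> ((nat \<Rightarrow> 's) \<Rightarrow> real) \<Rightarrow> real" where
  "quenched_avg n \<beta> f = (\<integral>g. replica_avg n \<beta> g f \<partial>gauss_PiM I)"

lemma cov_commute: "cov \<sigma> \<tau> = cov \<tau> \<sigma>"
  by (simp add: cov_def mult.commute)

lemma energy_measurable [measurable]: "(\<lambda>g. energy g \<sigma>) \<in> borel_measurable (gauss_PiM I)"
  unfolding energy_def
  by (intro borel_measurable_sum borel_measurable_times borel_measurable_const
      measurable_component_singleton [of _ _ "\<lambda>_. std_gauss", unfolded measurable_cong_sets [OF refl sets_std_gauss]])

lemma energy_fun_upd:
  assumes "i \<in> I"
  shows "energy (g(i := x)) \<sigma> = energy (g(i := 0)) \<sigma> + a i \<sigma> * x"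
proof -
  have "(\<Sum>j\<in>I - {i}. a j \<sigma> * (g(i := x)) j) = (\<Sum>j\<in>I - {i}. a j \<sigma> * (g(i := 0)) j)"
    by (intro sum.cong) auto
  then show ?thesis
    using finite_I assms by (simp add: energy_def sum.remove [of I i])
qed

lemma replica_avg_measurable [measurable]: "(\<lambda>g. replica_avg n \<beta> g f) \<in> borel_measurable (gauss_PiM I)"
  unfolding replica_avg_def gibbs_avg_def by measurable

text \<open>There are finitely many configurations, so the bound can be chosen independently of
  \<beta> and the disorder; integration by parts relies on this uniformity in
  \<open>g\<close>.\<close>

lemma replica_avg_bounded: "\<exists>B\<ge>0. \<forall>\<beta> g. \<bar>replica_avg n \<beta> g f\<bar> \<le> B"
proof (intro exI conjI allI)
  show "0 \<le> (\<Sum>s\<in>PiE {1..n} (\<lambda>_. S). \<bar>f s\<bar>)"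
    by (simp add: sum_nonneg)
  show "\<bar>replica_avg n \<beta> g f\<bar> \<le> (\<Sum>s\<in>PiE {1..n} (\<lambda>_. S). \<bar>f s\<bar>)" for \<beta> g
    unfolding replica_avg_def
    by (intro gibbs_avg_abs_le finite_S S_nonempty member_le_sum [where f = "\<lambda>s. \<bar>f s\<bar>"])
       (auto intro: finite_PiE finite_S)
qed

lemma replica_avg_integrable: "integrable (gauss_PiM I) (\<lambda>g. replica_avg n \<beta> g f)"
proof -
  obtain B where "\<And>\<beta> g. \<bar>replica_avg n \<beta> g f\<bar> \<le> B"
    using replica_avg_bounded by blast
  then show ?thesis
    by (intro gauss_prod.P.integrable_const_bound [where B = B]) auto
qed

lemma replica_avg_abs_le:
  assumes "\<And>s. s \<in> PiE {1..n} (\<lambda>_. S) \<Longrightarrow> \<bar>f s\<bar> \<le> B"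
  shows "\<bar>replica_avg n \<beta> g f\<bar> \<le> B"
  unfolding replica_avg_def using assms by (intro gibbs_avg_abs_le finite_S S_nonempty)

lemma quenched_avg_abs_le:
  assumes "\<And>s. s \<in> PiE {1..n} (\<lambda>_. S) \<Longrightarrow> \<bar>f s\<bar> \<le> B"
  shows "\<bar>quenched_avg n \<beta> f\<bar> \<le> B"
  unfolding quenched_avg_def
  by (intro order.trans [OF integral_abs_bound] gauss_prod.P.integral_le_const)
     (auto intro: replica_avg_integrable replica_avg_abs_le assms)

lemma quenched_avg_cong:
  assumes "\<And>s. s \<in> PiE {1..n} (\<lambda>_. S) \<Longrightarrow> f s = f' s"
  shows "quenched_avg n \<beta> f = quenched_avg n \<beta> f'"
  using gibbs_avg_cong [of n S f f'] assms by (simp add: quenched_avg_def replica_avg_def)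

lemma quenched_avg_add: "quenched_avg n \<beta> (\<lambda>s. f s + f' s) = quenched_avg n \<beta> f + quenched_avg n \<beta> f'"
  using replica_avg_integrable by (simp add: quenched_avg_def replica_avg_def gibbs_avg_add)

lemma quenched_avg_diff: "quenched_avg n \<beta> (\<lambda>s. f s - f' s) = quenched_avg n \<beta> f - quenched_avg n \<beta> f'"
  using replica_avg_integrable by (simp add: quenched_avg_def replica_avg_def gibbs_avg_diff)

lemma quenched_avg_cmult: "quenched_avg n \<beta> (\<lambda>s. c * f s) = c * quenched_avg n \<beta> f"
  by (simp add: quenched_avg_def replica_avg_def gibbs_avg_cmult)

lemma quenched_avg_sum: "quenched_avg n \<beta> (\<lambda>s. \<Sum>j\<in>A. f j s) = (\<Sum>j\<in>A. quenched_avg n \<beta> (f j))"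
  using replica_avg_integrable by (simp add: quenched_avg_def replica_avg_def gibbs_avg_sum)

lemma quenched_avg_const: "quenched_avg n \<beta> (\<lambda>_. c) = c"
  by (simp add: quenched_avg_def replica_avg_def gibbs_avg_const finite_S S_nonempty)

lemma quenched_avg_Suc:
  assumes "\<And>s x. f (s(Suc n := x)) = f s"
  shows "quenched_avg (Suc n) \<beta> f = quenched_avg n \<beta> f"
  using assms by (simp add: quenched_avg_def replica_avg_def gibbs_avg_Suc finite_S S_nonempty)

section \<open>Integration by parts against the disorder\<close>

lemma replica_avg_mult_energy:
  "replica_avg n \<beta> g (\<lambda>s. f s * energy g (s l)) = (\<Sum>i\<in>I. g i * replica_avg n \<beta> g (\<lambda>s. f s * a i (s l)))"
proof -
  have "replica_avg n \<beta> g (\<lambda>s. f s * energy g (s l)) = replica_avg n \<beta> g (\<lambda>s. \<Sum>i\<in>I. g i * (f s * a i (s l)))"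
    by (simp add: energy_def sum_distrib_left ac_simps)
  then show ?thesis
    by (simp add: replica_avg_def gibbs_avg_sum gibbs_avg_cmult)
qed

lemma component_replica_avg_integrable:
  assumes "i \<in> I"
  shows "integrable (gauss_PiM I) (\<lambda>g. g i * replica_avg n \<beta> g f)"
proof -
  obtain B where "\<And>\<beta> g. \<bar>replica_avg n \<beta> g f\<bar> \<le> B"
    using replica_avg_bounded by blast
  then show ?thesis
    by (rule integrable_mult_bounded
        [OF integrable_gauss_component [OF integrable_std_gauss_id assms] replica_avg_measurable])
qed

lemma replica_avg_energy_integrable:
  "integrable (gauss_PiM I) (\<lambda>g. replica_avg n \<beta> g (\<lambda>s. f s * energy g (s l)))"
  unfolding replica_avg_mult_energy by (intro Bochner_Integration.integrable_sum component_replica_avg_integrable)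

text \<open>As a function of one coupling the exponent is affine with slope
  \<open>\<beta> * a i \<sigma>\<close>, so the derivative of the Gibbs average is an average with
  one more replica.\<close>

lemma component_replica_avg_by_parts:
  assumes i: "i \<in> I" and f: "\<And>s x. f (s(Suc n := x)) = f s"
  shows "(\<integral>g. g i * replica_avg n \<beta> g f \<partial>gauss_PiM I)
    = \<beta> * quenched_avg (Suc n) \<beta> (\<lambda>s. f s * ((\<Sum>k=1..n. a i (s k)) - real n * a i (s (Suc n))))"
proof -
  let ?h = "\<lambda>s. f s * ((\<Sum>k=1..n. \<beta> * a i (s k)) - real n * (\<beta> * a i (s (Suc n))))"
  have u: "((\<lambda>x. \<beta> * energy (g(i := x)) \<sigma>) has_real_derivative \<beta> * a i \<sigma>) (at x)" for g x \<sigma>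
  proof -
    define c where "c = energy (g(i := 0)) \<sigma>"
    show ?thesis
      unfolding energy_fun_upd [OF i, of g _ \<sigma>, folded c_def] by (auto intro!: derivative_eq_intros)
  qed
  have deriv: "((\<lambda>x. replica_avg n \<beta> (g(i := x)) f) has_real_derivative replica_avg (Suc n) \<beta> (g(i := x)) ?h) (at x)" for g x
    unfolding replica_avg_def
    using has_real_derivative_gibbs_avg [where u = "\<lambda>x \<sigma>. \<beta> * energy (g(i := x)) \<sigma>"
        and u' = "\<lambda>\<sigma>. \<beta> * a i \<sigma>" and x = x and f = f and n = n, OF finite_S S_nonempty u f] .
  have cont: "isCont (\<lambda>x. replica_avg (Suc n) \<beta> (g(i := x)) ?h) x" for g x
    unfolding replica_avg_def
    by (rule isCont_gibbs_avg [where u = "\<lambda>x \<sigma>. \<beta> * energy (g(i := x)) \<sigma>", OF finite_S S_nonempty])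
       (rule DERIV_isCont [OF u])
  obtain B B' where "\<And>g. \<bar>replica_avg n \<beta> g f\<bar> \<le> B" "\<And>g. \<bar>replica_avg (Suc n) \<beta> g ?h\<bar> \<le> B'"
    using replica_avg_bounded [of n f] replica_avg_bounded [of "Suc n" ?h] by blast
  from gauss_PiM_integral_by_parts [OF finite_I i replica_avg_measurable replica_avg_measurable deriv cont this]
  have "(\<integral>g. g i * replica_avg n \<beta> g f \<partial>gauss_PiM I) = quenched_avg (Suc n) \<beta> ?h"
    by (simp add: quenched_avg_def)
  also have "?h = (\<lambda>s. \<beta> * (f s * ((\<Sum>k=1..n. a i (s k)) - real n * a i (s (Suc n)))))"
    by (simp add: algebra_simps sum_distrib_left)
  finally show ?thesis by (simp add: quenched_avg_cmult)
qed

text \<open>Summing the one-coupling formula over \<open>i\<close> pairs \<open>a i\<close> at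
  replica \<open>l\<close> with \<open>a i\<close> at each replica, which builds the covariance. The
  term \<open>k = l\<close> is included and yields the self-overlap.\<close>

lemma quenched_avg_mult_energy_by_parts:
  assumes f: "\<And>s x. f (s(Suc n := x)) = f s" and l: "l \<in> {1..n}"
  shows "(\<integral>g. replica_avg n \<beta> g (\<lambda>s. f s * energy g (s l)) \<partial>gauss_PiM I)
    = \<beta> * quenched_avg (Suc n) \<beta> (\<lambda>s. f s * ((\<Sum>k=1..n. cov (s l) (s k)) - real n * cov (s l) (s (Suc n))))"
proof -
  have "(\<integral>g. replica_avg n \<beta> g (\<lambda>s. f s * energy g (s l)) \<partial>gauss_PiM I)
      = (\<Sum>i\<in>I. \<integral>g. g i * replica_avg n \<beta> g (\<lambda>s. f s * a i (s l)) \<partial>gauss_PiM I)"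
    unfolding replica_avg_mult_energy using component_replica_avg_integrable by (intro Bochner_Integration.integral_sum)
  also have "\<dots> = (\<Sum>i\<in>I. \<beta> * quenched_avg (Suc n) \<beta>
      (\<lambda>s. f s * a i (s l) * ((\<Sum>k=1..n. a i (s k)) - real n * a i (s (Suc n)))))"
    using f l by (intro sum.cong refl component_replica_avg_by_parts) auto
  also have "\<dots> = \<beta> * quenched_avg (Suc n) \<beta> (\<lambda>s. \<Sum>i\<in>I.
      f s * a i (s l) * ((\<Sum>k=1..n. a i (s k)) - real n * a i (s (Suc n))))"
    by (simp add: quenched_avg_sum sum_distrib_left)
  also have "(\<lambda>s. \<Sum>i\<in>I. f s * a i (s l) * ((\<Sum>k=1..n. a i (s k)) - real n * a i (s (Suc n))))
      = (\<lambda>s. f s * ((\<Sum>k=1..n. cov (s l) (s k)) - real n * cov (s l) (s (Suc n))))"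
  proof
    fix s :: "nat \<Rightarrow> 's"
    have "(\<Sum>k=1..n. cov (s l) (s k)) = (\<Sum>i\<in>I. a i (s l) * (\<Sum>k=1..n. a i (s k)))"
      by (simp add: cov_def sum_distrib_left sum.swap [of _ I])
    then show "(\<Sum>i\<in>I. f s * a i (s l) * ((\<Sum>k=1..n. a i (s k)) - real n * a i (s (Suc n))))
      = f s * ((\<Sum>k=1..n. cov (s l) (s k)) - real n * cov (s l) (s (Suc n)))"
      unfolding cov_def
      by (simp add: right_diff_distrib sum_subtractf sum_distrib_left mult.assoc mult.left_commute)
  qed
  finally show ?thesis .
qed

section \<open>Differentiating quenched averages in the inverse temperature\<close>

definition energy_bound :: "('i \<Rightarrow> real) \<Rightarrow> real" where
  "energy_bound g = (\<Sum>i\<in>I. (\<Sum>\<sigma>\<in>S. \<bar>a i \<sigma>\<bar>) * \<bar>g i\<bar>)"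

lemma abs_energy_le:
  assumes "\<sigma> \<in> S"
  shows "\<bar>energy g \<sigma>\<bar> \<le> energy_bound g"
  unfolding energy_def energy_bound_def
  by (intro order.trans [OF sum_abs] sum_mono)
     (auto simp: abs_mult intro!: mult_right_mono member_le_sum [OF assms, of "\<lambda>\<sigma>. \<bar>a _ \<sigma>\<bar>"] finite_S)

lemma energy_bound_integrable: "integrable (gauss_PiM I) energy_bound"
  unfolding energy_bound_def
  by (intro Bochner_Integration.integrable_sum integrable_mult_right
      integrable_gauss_component [where h = "\<lambda>x. \<bar>x\<bar>"] integrable_abs integrable_std_gauss_id)

lemma replica_avg_energy_diff:
  "replica_avg n \<beta> g (\<lambda>s. f s * ((\<Sum>k\<in>A. energy g (s k)) - c * energy g (s m)))
    = (\<Sum>k\<in>A. replica_avg n \<beta> g (\<lambda>s. f s * energy g (s k))) - c * replica_avg n \<beta> g (\<lambda>s. f s * energy g (s m))"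
proof -
  have "replica_avg n \<beta> g (\<lambda>s. f s * ((\<Sum>k\<in>A. energy g (s k)) - c * energy g (s m)))
     = replica_avg n \<beta> g (\<lambda>s. (\<Sum>k\<in>A. f s * energy g (s k)) - c * (f s * energy g (s m)))"
    by (simp add: right_diff_distrib sum_distrib_left mult.left_commute)
  then show ?thesis
    by (simp add: replica_avg_def gibbs_avg_diff gibbs_avg_sum gibbs_avg_cmult)
qed

lemma quenched_avg_has_real_derivative:
  assumes f: "\<And>s x. f (s(Suc n := x)) = f s" and B: "\<And>s. \<bar>f s\<bar> \<le> B"
  shows "((\<lambda>\<beta>. quenched_avg n \<beta> f) has_real_derivative
    (\<Sum>k=1..n. \<integral>g. replica_avg (Suc n) \<beta> g (\<lambda>s. f s * energy g (s k)) \<partial>gauss_PiM I)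
      - real n * (\<integral>g. replica_avg (Suc n) \<beta> g (\<lambda>s. f s * energy g (s (Suc n))) \<partial>gauss_PiM I)) (at \<beta>)"
proof -
  let ?h = "\<lambda>g s. f s * ((\<Sum>k=1..n. energy g (s k)) - real n * energy g (s (Suc n)))"
  have h_int: "integrable (gauss_PiM I) (\<lambda>g. replica_avg (Suc n) \<beta> g (?h g))" for \<beta>
    unfolding replica_avg_energy_diff
    by (intro Bochner_Integration.integrable_diff Bochner_Integration.integrable_sum
        integrable_mult_right replica_avg_energy_integrable)
  have deriv: "((\<lambda>\<beta>. quenched_avg n \<beta> f) has_real_derivative (\<integral>g. replica_avg (Suc n) \<beta> g (?h g) \<partial>gauss_PiM I)) (at \<beta>)"
    unfolding quenched_avg_def
  \<comment> \<open>\<open>energy_bound\<close> controls the energy of every configuration, hence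
    its Gibbs average at any \<beta>. The factor \<open>2 * real n\<close> counts \<open>n\<close>
    replicas and the additional one with weight \<open>n\<close>.\<close>
  proof (rule has_real_derivative_integral [where B = "\<lambda>g. B * (2 * real n * energy_bound g)"])
    show "((\<lambda>\<beta>. replica_avg n \<beta> g f) has_real_derivative replica_avg (Suc n) \<beta> g (?h g)) (at \<beta>)" for \<beta> g
      unfolding replica_avg_def
      by (rule has_real_derivative_gibbs_avg [where u = "\<lambda>\<beta> \<sigma>. \<beta> * energy g \<sigma>"
          and u' = "energy g" and x = \<beta> and f = f and n = n, OF finite_S S_nonempty _ f])
        (auto intro!: derivative_eq_intros)
    show "\<bar>replica_avg (Suc n) \<beta> g (?h g)\<bar> \<le> B * (2 * real n * energy_bound g)" for \<beta> g
    proof (rule replica_avg_abs_le)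
      fix s assume s: "s \<in> PiE {1..Suc n} (\<lambda>_. S)"
      then have e: "\<bar>energy g (s k)\<bar> \<le> energy_bound g" if "k \<in> {1..Suc n}" for k
        using that by (intro abs_energy_le) auto
      have "\<bar>\<Sum>k=1..n. energy g (s k)\<bar> \<le> (\<Sum>k=1..n. energy_bound g)"
        by (intro order.trans [OF sum_abs] sum_mono e) auto
      moreover have "\<bar>real n * energy g (s (Suc n))\<bar> \<le> real n * energy_bound g"
        using e [of "Suc n"] by (simp add: abs_mult mult_left_mono)
      ultimately have "\<bar>(\<Sum>k=1..n. energy g (s k)) - real n * energy g (s (Suc n))\<bar>
          \<le> 2 * real n * energy_bound g"
        by simp
      moreover have "0 \<le> B" using B [of s] by linarith
      ultimately show "\<bar>?h g s\<bar> \<le> B * (2 * real n * energy_bound g)"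
        unfolding abs_mult using B by (intro mult_mono) auto
    qed
    show "integrable (gauss_PiM I) (\<lambda>g. B * (2 * real n * energy_bound g))"
      by (intro integrable_mult_right energy_bound_integrable)
    show "(\<lambda>g. replica_avg (Suc n) \<beta> g (?h g)) \<in> borel_measurable (gauss_PiM I)"
      by (rule borel_measurable_integrable [OF h_int])
  qed (rule replica_avg_integrable)
  have "(\<integral>g. replica_avg (Suc n) \<beta> g (?h g) \<partial>gauss_PiM I)
     = (\<Sum>k=1..n. \<integral>g. replica_avg (Suc n) \<beta> g (\<lambda>s. f s * energy g (s k)) \<partial>gauss_PiM I)
      - real n * (\<integral>g. replica_avg (Suc n) \<beta> g (\<lambda>s. f s * energy g (s (Suc n))) \<partial>gauss_PiM I)"
    unfolding replica_avg_energy_diff by (simp add: replica_avg_energy_integrable)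
  with deriv show ?thesis
    by (simp only:)
qed

text \<open>Replica \<open>R + 1\<close> is one that \<open>f\<close> does not see. Its self-overlap
  is split off as \<open>c0\<close> because it has to cancel in both identities.\<close>

lemma last_energy_by_parts:
  assumes f: "\<And>k s x. R < k \<Longrightarrow> f (s(k := x)) = f s"
    and diag: "\<And>\<sigma>. \<sigma> \<in> S \<Longrightarrow> cov \<sigma> \<sigma> = c0"
  shows "(\<integral>g. replica_avg (R + 1) \<beta> g (\<lambda>s. f s * energy g (s (R + 1))) \<partial>gauss_PiM I)
    = \<beta> * quenched_avg (R + 2) \<beta> (\<lambda>s. f s * ((\<Sum>k=1..R. cov (s k) (s (R + 1))) + c0
        - real (R + 1) * cov (s (R + 1)) (s (R + 2))))"
proof -
  have "quenched_avg (Suc (R + 1)) \<beta> (\<lambda>s. f s * ((\<Sum>k=1..R + 1. cov (s (R + 1)) (s k))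
        - real (R + 1) * cov (s (R + 1)) (s (Suc (R + 1)))))
     = quenched_avg (R + 2) \<beta> (\<lambda>s. f s * ((\<Sum>k=1..R. cov (s k) (s (R + 1))) + c0
        - real (R + 1) * cov (s (R + 1)) (s (R + 2))))"
    unfolding add_Suc_right [symmetric] Suc_1
  proof (rule quenched_avg_cong)
    fix s assume "s \<in> PiE {1..R + 2} (\<lambda>_. S)"
    then have "cov (s (R + 1)) (s (R + 1)) = c0"
      by (intro diag) auto
    then have "(\<Sum>k=1..R + 1. cov (s (R + 1)) (s k)) = (\<Sum>k=1..R. cov (s k) (s (R + 1))) + c0"
      by (simp add: cov_commute)
    then show "f s * ((\<Sum>k=1..R + 1. cov (s (R + 1)) (s k)) - real (R + 1) * cov (s (R + 1)) (s (R + 2)))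
      = f s * ((\<Sum>k=1..R. cov (s k) (s (R + 1))) + c0 - real (R + 1) * cov (s (R + 1)) (s (R + 2)))"
      by (simp only:)
  qed
  then show ?thesis
    using quenched_avg_mult_energy_by_parts [of f "R + 1" "R + 1" \<beta>] f by simp
qed

text \<open>The energy of each replica up to \<open>R\<close> gives its overlaps with
  \<open>1..R\<close> and \<open>- R\<close> times that with \<open>R + 1\<close>; the energy of
  replica \<open>R + 1\<close> enters with weight \<open>- R\<close>. Overlaps with
  \<open>R + 1\<close> therefore collect \<open>- 2 * R\<close>, and the self-overlaps
  \<open>R * c0\<close> and \<open>- R * c0\<close> cancel.\<close>

lemma quenched_avg_derivative_overlaps:
  assumes f: "\<And>k s x. R < k \<Longrightarrow> f (s(k := x)) = f s" and B: "\<And>s. \<bar>f s\<bar> \<le> B"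
    and diag: "\<And>\<sigma>. \<sigma> \<in> S \<Longrightarrow> cov \<sigma> \<sigma> = c0"
  shows "((\<lambda>\<beta>. quenched_avg R \<beta> f) has_real_derivative \<beta> * quenched_avg (R + 2) \<beta> (\<lambda>s.
      (\<Sum>k=1..R. \<Sum>l\<in>{1..R} - {k}. f s * cov (s l) (s k))
      - 2 * real R * f s * (\<Sum>l=1..R. cov (s l) (s (R + 1)))
      + real R * real (R + 1) * f s * cov (s (R + 1)) (s (R + 2)))) (at \<beta>)"
proof -
  \<comment> \<open>Only \<open>R\<close> replicas occur here, so integration by parts leads to
    \<open>R + 1\<close>; the average is then lifted to \<open>R + 2\<close> replicas in order to be
    combined with the energy of replica \<open>R + 1\<close>.\<close>
  have first: "(\<integral>g. replica_avg (Suc R) \<beta> g (\<lambda>s. f s * energy g (s k)) \<partial>gauss_PiM I)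
      = \<beta> * quenched_avg (R + 2) \<beta> (\<lambda>s. f s * ((\<Sum>l=1..R. cov (s k) (s l)) - real R * cov (s k) (s (R + 1))))"
    if k: "k \<in> {1..R}" for k
  proof -
    have "replica_avg (Suc R) \<beta> g (\<lambda>s. f s * energy g (s k)) = replica_avg R \<beta> g (\<lambda>s. f s * energy g (s k))" for g
      unfolding replica_avg_def using k f by (intro gibbs_avg_Suc finite_S S_nonempty) auto
    then have "(\<integral>g. replica_avg (Suc R) \<beta> g (\<lambda>s. f s * energy g (s k)) \<partial>gauss_PiM I)
       = \<beta> * quenched_avg (Suc R) \<beta> (\<lambda>s. f s * ((\<Sum>l=1..R. cov (s k) (s l)) - real R * cov (s k) (s (Suc R))))"
      using quenched_avg_mult_energy_by_parts [of f R k \<beta>] f k by simp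
    also have "quenched_avg (Suc R) \<beta> (\<lambda>s. f s * ((\<Sum>l=1..R. cov (s k) (s l)) - real R * cov (s k) (s (Suc R))))
       = quenched_avg (Suc (Suc R)) \<beta> (\<lambda>s. f s * ((\<Sum>l=1..R. cov (s k) (s l)) - real R * cov (s k) (s (Suc R))))"
      using k f by (intro quenched_avg_Suc [symmetric]) auto
    finally show ?thesis by simp
  qed
  have deriv: "((\<lambda>\<beta>. quenched_avg R \<beta> f) has_real_derivative
     (\<Sum>k=1..R. \<beta> * quenched_avg (R + 2) \<beta> (\<lambda>s. f s * ((\<Sum>l=1..R. cov (s k) (s l)) - real R * cov (s k) (s (R + 1)))))
     - real R * (\<beta> * quenched_avg (R + 2) \<beta> (\<lambda>s. f s * ((\<Sum>k=1..R. cov (s k) (s (R + 1))) + c0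
        - real (R + 1) * cov (s (R + 1)) (s (R + 2)))))) (at \<beta>)"
    using quenched_avg_has_real_derivative [of f R B \<beta>] f B first last_energy_by_parts [where \<beta> = \<beta> and f = f and R = R, OF f diag] by simp
  have "(\<Sum>k=1..R. \<beta> * quenched_avg (R + 2) \<beta> (\<lambda>s. f s * ((\<Sum>l=1..R. cov (s k) (s l)) - real R * cov (s k) (s (R + 1)))))
     - real R * (\<beta> * quenched_avg (R + 2) \<beta> (\<lambda>s. f s * ((\<Sum>k=1..R. cov (s k) (s (R + 1))) + c0
        - real (R + 1) * cov (s (R + 1)) (s (R + 2)))))
    = \<beta> * quenched_avg (R + 2) \<beta> (\<lambda>s. (\<Sum>k=1..R. f s * ((\<Sum>l=1..R. cov (s k) (s l)) - real R * cov (s k) (s (R + 1))))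
      - real R * (f s * ((\<Sum>k=1..R. cov (s k) (s (R + 1))) + c0
        - real (R + 1) * cov (s (R + 1)) (s (R + 2)))))"
    unfolding quenched_avg_diff quenched_avg_sum quenched_avg_cmult [of _ _ "real R"] by (simp add: sum_distrib_left algebra_simps)
  also have "quenched_avg (R + 2) \<beta> (\<lambda>s. (\<Sum>k=1..R. f s * ((\<Sum>l=1..R. cov (s k) (s l)) - real R * cov (s k) (s (R + 1))))
      - real R * (f s * ((\<Sum>k=1..R. cov (s k) (s (R + 1))) + c0
        - real (R + 1) * cov (s (R + 1)) (s (R + 2)))))
    = quenched_avg (R + 2) \<beta> (\<lambda>s.
      (\<Sum>k=1..R. \<Sum>l\<in>{1..R} - {k}. f s * cov (s l) (s k))
      - 2 * real R * f s * (\<Sum>l=1..R. cov (s l) (s (R + 1)))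
      + real R * real (R + 1) * f s * cov (s (R + 1)) (s (R + 2)))"
  proof (rule quenched_avg_cong)
    fix s assume s: "s \<in> PiE {1..R + 2} (\<lambda>_. S)"
    have "(\<Sum>l=1..R. cov (s k) (s l)) = c0 + (\<Sum>l\<in>{1..R} - {k}. cov (s l) (s k))" if "k \<in> {1..R}" for k
    proof -
      have "cov (s k) (s k) = c0"
        using s that by (intro diag) auto
      then show ?thesis
        using that by (subst sum.remove [of "{1..R}" k]) (auto simp: cov_commute)
    qed
    then have "(\<Sum>k=1..R. f s * ((\<Sum>l=1..R. cov (s k) (s l)) - real R * cov (s k) (s (R + 1))))
      = (\<Sum>k=1..R. f s * c0 + (\<Sum>l\<in>{1..R} - {k}. f s * cov (s l) (s k)) - real R * f s * cov (s k) (s (R + 1)))"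
      by (intro sum.cong refl) (simp add: algebra_simps sum_distrib_left)
    also have "\<dots> = real R * f s * c0 + (\<Sum>k=1..R. \<Sum>l\<in>{1..R} - {k}. f s * cov (s l) (s k))
        - real R * f s * (\<Sum>k=1..R. cov (s k) (s (R + 1)))"
      by (simp add: sum.distrib sum_subtractf sum_distrib_left)
    finally show "(\<Sum>k=1..R. f s * ((\<Sum>l=1..R. cov (s k) (s l)) - real R * cov (s k) (s (R + 1))))
      - real R * (f s * ((\<Sum>k=1..R. cov (s k) (s (R + 1))) + c0
        - real (R + 1) * cov (s (R + 1)) (s (R + 2))))
      = (\<Sum>k=1..R. \<Sum>l\<in>{1..R} - {k}. f s * cov (s l) (s k))
      - 2 * real R * f s * (\<Sum>l=1..R. cov (s l) (s (R + 1)))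
      + real R * real (R + 1) * f s * cov (s (R + 1)) (s (R + 2))"
      by (simp add: algebra_simps)
  qed
  finally show ?thesis
    using deriv by (simp only:)
qed

lemma stability_integral_bound:
  assumes f: "\<And>k s x. R < k \<Longrightarrow> f (s(k := x)) = f s" and B: "\<And>s. \<bar>f s\<bar> \<le> 1"
    and diag: "\<And>\<sigma>. \<sigma> \<in> S \<Longrightarrow> cov \<sigma> \<sigma> = c0" and \<beta>: "0 < \<beta>1" "\<beta>1 < \<beta>2"
  shows "\<bar>integral {\<beta>1\<^sup>2..\<beta>2\<^sup>2} (\<lambda>t. quenched_avg (R + 2) (sqrt t) (\<lambda>s.
      (\<Sum>k=1..R. \<Sum>l\<in>{1..R} - {k}. f s * cov (s l) (s k))
      - 2 * real R * f s * (\<Sum>l=1..R. cov (s l) (s (R + 1)))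
      + real R * real (R + 1) * f s * cov (s (R + 1)) (s (R + 2))))\<bar> \<le> 4"
    (is "\<bar>integral _ (\<lambda>t. quenched_avg _ _ ?T)\<bar> \<le> 4")
proof -
  have "((\<lambda>t. quenched_avg (R + 2) (sqrt t) ?T) has_integral 2 * quenched_avg R (sqrt (\<beta>2\<^sup>2)) f - 2 * quenched_avg R (sqrt (\<beta>1\<^sup>2)) f) {\<beta>1\<^sup>2..\<beta>2\<^sup>2}"
  proof (rule fundamental_theorem_of_calculus)
    show "\<beta>1\<^sup>2 \<le> \<beta>2\<^sup>2" using \<beta> by (intro power_mono) auto
    fix t assume "t \<in> {\<beta>1\<^sup>2..\<beta>2\<^sup>2}"
    then have t: "0 < t" using \<beta> by (auto intro: less_le_trans [of 0 "\<beta>1\<^sup>2"])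
    \<comment> \<open>The chain-rule factor \<open>inverse (sqrt t) / 2\<close> cancels the \<beta>
      in front of the overlaps.\<close>
    have "((\<lambda>t. quenched_avg R (sqrt t) f) has_real_derivative sqrt t * quenched_avg (R + 2) (sqrt t) ?T * (inverse (sqrt t) / 2)) (at t)"
      using DERIV_chain2 [where f = "\<lambda>\<beta>. quenched_avg R \<beta> f" and g = sqrt, OF quenched_avg_derivative_overlaps DERIV_real_sqrt [OF t]]
        f B diag by blast
    then have "((\<lambda>t. 2 * quenched_avg R (sqrt t) f) has_real_derivative
        2 * (sqrt t * quenched_avg (R + 2) (sqrt t) ?T * (inverse (sqrt t) / 2))) (at t)"
      by (rule DERIV_cmult)
    moreover have "2 * (sqrt t * q * (inverse (sqrt t) / 2)) = q" for q
      using t by (simp add: field_simps)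
    ultimately have "((\<lambda>t. 2 * quenched_avg R (sqrt t) f) has_real_derivative quenched_avg (R + 2) (sqrt t) ?T) (at t)"
      by (simp only:)
    then show "((\<lambda>t. 2 * quenched_avg R (sqrt t) f) has_vector_derivative quenched_avg (R + 2) (sqrt t) ?T) (at t within {\<beta>1\<^sup>2..\<beta>2\<^sup>2})"
      by (simp add: has_real_derivative_iff_has_vector_derivative has_vector_derivative_at_within)
  qed
  then have "integral {\<beta>1\<^sup>2..\<beta>2\<^sup>2} (\<lambda>t. quenched_avg (R + 2) (sqrt t) ?T)
      = 2 * quenched_avg R (sqrt (\<beta>2\<^sup>2)) f - 2 * quenched_avg R (sqrt (\<beta>1\<^sup>2)) f"
    by (rule integral_unique)
  moreover have "\<bar>quenched_avg R \<beta> f\<bar> \<le> 1" for \<beta>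
    by (rule quenched_avg_abs_le) (rule B)
  then have "\<bar>2 * quenched_avg R (sqrt (\<beta>2\<^sup>2)) f - 2 * quenched_avg R (sqrt (\<beta>1\<^sup>2)) f\<bar> \<le> 4"
    unfolding abs_le_iff by (smt (verit))
  ultimately show ?thesis
    by (simp only:)
qed

section \<open>The second identity as a covariance with the energy\<close>

definition logZ :: "real \<Rightarrow> ('i \<Rightarrow> real) \<Rightarrow> real" where
  "logZ \<beta> g = ln (\<Sum>\<sigma>\<in>S. exp (\<beta> * energy g \<sigma>))"

text \<open>The quenched log-partition function, divided neither by the volume nor by
  \<beta>.\<close>

definition pressure :: "real \<Rightarrow> real" where
  "pressure \<beta> = (\<integral>g. logZ \<beta> g \<partial>gauss_PiM I)"

definition quenched_energy :: "real \<Rightarrow> real" where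
  "quenched_energy \<beta> = (\<integral>g. mean_energy \<beta> g \<partial>gauss_PiM I)"

lemma logZ_measurable [measurable]: "logZ \<beta> \<in> borel_measurable (gauss_PiM I)"
  unfolding logZ_def by measurable

text \<open>\<open>mean_energy\<close> is the slope of \<open>logZ\<close> in \<beta>. As
  \<open>h\<close> may have either sign, the inequality bounds this slope from both sides by
  difference quotients.\<close>

lemma logZ_convex: "logZ \<beta> g + h * mean_energy \<beta> g \<le> logZ (\<beta> + h) g"
proof -
  have "gibbs_mean S (\<lambda>\<sigma>. \<beta> * energy g \<sigma>) (\<lambda>\<sigma>. h * energy g \<sigma>) = h * mean_energy \<beta> g"
    by (simp add: mean_energy_def gibbs_mean_def sum_distrib_left mult.assoc)
  then show ?thesis
    using ln_partition_sum_ge [OF finite_S S_nonempty, of "\<lambda>\<sigma>. \<beta> * energy g \<sigma>" "\<lambda>\<sigma>. h * energy g \<sigma>"]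
    by (simp add: logZ_def distrib_right)
qed

text \<open>The factor \<open>1\<close> gives the mean the shape \<open>f s * energy g (s l)\<close>
  on which integration by parts operates.\<close>

lemma mean_energy_eq_replica_avg: "mean_energy \<beta> g = replica_avg 1 \<beta> g (\<lambda>s. 1 * energy g (s 1))"
  unfolding mean_energy_def replica_avg_def using gibbs_avg_1 [OF finite_S, of _ "energy g"] by simp

lemma mean_energy_integrable: "integrable (gauss_PiM I) (mean_energy \<beta>)"
  using replica_avg_energy_integrable [of 1 \<beta> "\<lambda>_. 1" 1] by (simp only: mean_energy_eq_replica_avg [symmetric])

lemma quenched_energy_eq:
  assumes diag: "\<And>\<sigma>. \<sigma> \<in> S \<Longrightarrow> cov \<sigma> \<sigma> = c0"
  shows "quenched_energy \<beta> = \<beta> * (c0 - quenched_avg 2 \<beta> (\<lambda>s. cov (s 1) (s 2)))"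
proof -
  have "quenched_energy \<beta> = \<beta> * quenched_avg (Suc 1) \<beta> (\<lambda>s. 1 * ((\<Sum>k=1..1. cov (s 1) (s k)) - real 1 * cov (s 1) (s (Suc 1))))"
    unfolding quenched_energy_def mean_energy_eq_replica_avg by (rule quenched_avg_mult_energy_by_parts) auto
  also have "quenched_avg (Suc 1) \<beta> (\<lambda>s. 1 * ((\<Sum>k=1..1. cov (s 1) (s k)) - real 1 * cov (s 1) (s (Suc 1))))
     = quenched_avg 2 \<beta> (\<lambda>s. c0 - cov (s 1) (s 2))"
    unfolding Suc_1 by (rule quenched_avg_cong) (auto intro!: diag)
  finally show ?thesis
    by (simp add: quenched_avg_diff quenched_avg_const)
qed

text \<open>The product of the Gibbs averages of \<open>f\<close> and the energy is an average over
  \<open>R + 1\<close> replicas, so integration by parts applies to the last energy. Its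
  self-overlap contributes \<open>c0\<close> times the average of \<open>f\<close>, as does the
  product with \<open>quenched_energy\<close>, and the difference is free of
  \<open>c0\<close>.\<close>

lemma GG_eq_covariance:
  assumes f: "\<And>k s x. R < k \<Longrightarrow> f (s(k := x)) = f s"
    and diag: "\<And>\<sigma>. \<sigma> \<in> S \<Longrightarrow> cov \<sigma> \<sigma> = c0"
  shows "\<beta> * ((\<Sum>k=1..R. quenched_avg (R + 1) \<beta> (\<lambda>s. f s * cov (s k) (s (R + 1))))
      - real (R + 1) * quenched_avg (R + 2) \<beta> (\<lambda>s. f s * cov (s (R + 1)) (s (R + 2)))
      + quenched_avg R \<beta> f * quenched_avg 2 \<beta> (\<lambda>s. cov (s 1) (s 2)))
    = (\<integral>g. (mean_energy \<beta> g - quenched_energy \<beta>) * replica_avg R \<beta> g f \<partial>gauss_PiM I)"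
proof -
  have energy: "quenched_energy \<beta> = \<beta> * (c0 - quenched_avg 2 \<beta> (\<lambda>s. cov (s 1) (s 2)))"
    using quenched_energy_eq diag by blast
  have replica_avg: "replica_avg (R + 1) \<beta> g (\<lambda>s. f s * energy g (s (R + 1))) = replica_avg R \<beta> g f * mean_energy \<beta> g" for g
    unfolding replica_avg_def mean_energy_def using gibbs_avg_Suc_mult [OF finite_S, of f R _ "energy g"] f by simp
  have int: "integrable (gauss_PiM I) (\<lambda>g. replica_avg R \<beta> g f * mean_energy \<beta> g)"
    using replica_avg_energy_integrable [of "R + 1" \<beta> f "R + 1"] by (simp only: replica_avg)
  have lift1: "quenched_avg (R + 2) \<beta> (\<lambda>s. f s * cov (s k) (s (R + 1))) = quenched_avg (R + 1) \<beta> (\<lambda>s. f s * cov (s k) (s (R + 1)))"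
    if "k \<in> {1..R}" for k
    using quenched_avg_Suc [of "\<lambda>s. f s * cov (s k) (s (R + 1))" "R + 1" \<beta>] f that by simp
  have lift0: "quenched_avg (R + 2) \<beta> f = quenched_avg R \<beta> f"
    using quenched_avg_Suc [of f "R + 1" \<beta>] quenched_avg_Suc [of f R \<beta>] f by simp
  have "(\<integral>g. replica_avg R \<beta> g f * mean_energy \<beta> g \<partial>gauss_PiM I)
    = \<beta> * quenched_avg (R + 2) \<beta> (\<lambda>s. f s * ((\<Sum>k=1..R. cov (s k) (s (R + 1))) + c0
        - real (R + 1) * cov (s (R + 1)) (s (R + 2))))"
    using last_energy_by_parts [where \<beta> = \<beta> and f = f and R = R, OF f diag] by (simp only: replica_avg)
  also have "(\<lambda>s. f s * ((\<Sum>k=1..R. cov (s k) (s (R + 1))) + c0 - real (R + 1) * cov (s (R + 1)) (s (R + 2))))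
    = (\<lambda>s. (\<Sum>k=1..R. f s * cov (s k) (s (R + 1))) + c0 * f s
        - real (R + 1) * (f s * cov (s (R + 1)) (s (R + 2))))"
    by (simp add: algebra_simps sum_distrib_left)
  also have "quenched_avg (R + 2) \<beta> \<dots> = (\<Sum>k=1..R. quenched_avg (R + 1) \<beta> (\<lambda>s. f s * cov (s k) (s (R + 1))))
      + c0 * quenched_avg R \<beta> f - real (R + 1) * quenched_avg (R + 2) \<beta> (\<lambda>s. f s * cov (s (R + 1)) (s (R + 2)))"
    unfolding quenched_avg_add quenched_avg_diff quenched_avg_sum quenched_avg_cmult lift0 using lift1 by simp
  finally have "(\<integral>g. replica_avg R \<beta> g f * mean_energy \<beta> g \<partial>gauss_PiM I) - quenched_energy \<beta> * quenched_avg R \<beta> f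
    = \<beta> * ((\<Sum>k=1..R. quenched_avg (R + 1) \<beta> (\<lambda>s. f s * cov (s k) (s (R + 1))))
      - real (R + 1) * quenched_avg (R + 2) \<beta> (\<lambda>s. f s * cov (s (R + 1)) (s (R + 2)))
      + quenched_avg R \<beta> f * quenched_avg 2 \<beta> (\<lambda>s. cov (s 1) (s 2)))"
    unfolding energy by (simp add: algebra_simps)
  moreover have "(\<integral>g. (mean_energy \<beta> g - quenched_energy \<beta>) * replica_avg R \<beta> g f \<partial>gauss_PiM I)
    = (\<integral>g. replica_avg R \<beta> g f * mean_energy \<beta> g \<partial>gauss_PiM I) - quenched_energy \<beta> * quenched_avg R \<beta> f"
    using int replica_avg_integrable by (simp add: quenched_avg_def left_diff_distrib mult.commute [of "mean_energy _ _"])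
  ultimately show ?thesis by simp
qed

lemma abs_GG_le:
  assumes f: "\<And>k s x. R < k \<Longrightarrow> f (s(k := x)) = f s" and B: "\<And>s. \<bar>f s\<bar> \<le> 1"
    and diag: "\<And>\<sigma>. \<sigma> \<in> S \<Longrightarrow> cov \<sigma> \<sigma> = c0"
  shows "\<bar>\<beta> * ((\<Sum>k=1..R. quenched_avg (R + 1) \<beta> (\<lambda>s. f s * cov (s k) (s (R + 1))))
      - real (R + 1) * quenched_avg (R + 2) \<beta> (\<lambda>s. f s * cov (s (R + 1)) (s (R + 2)))
      + quenched_avg R \<beta> f * quenched_avg 2 \<beta> (\<lambda>s. cov (s 1) (s 2)))\<bar>
    \<le> (\<integral>g. \<bar>mean_energy \<beta> g - quenched_energy \<beta>\<bar> \<partial>gauss_PiM I)"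
    (is "\<bar>?lhs\<bar> \<le> _")
proof -
  have "?lhs = (\<integral>g. (mean_energy \<beta> g - quenched_energy \<beta>) * replica_avg R \<beta> g f \<partial>gauss_PiM I)"
    using GG_eq_covariance [of R f c0 \<beta>] f diag by blast
  also have "\<bar>\<dots>\<bar>
    \<le> (\<integral>g. \<bar>mean_energy \<beta> g - quenched_energy \<beta>\<bar> \<partial>gauss_PiM I)"
  proof (rule order.trans [OF integral_abs_bound], rule integral_mono)
    have replica_avg: "\<bar>replica_avg R \<beta> g f\<bar> \<le> 1" for g by (rule replica_avg_abs_le) (rule B)
    have int: "integrable (gauss_PiM I) (\<lambda>g. mean_energy \<beta> g - quenched_energy \<beta>)"
      using mean_energy_integrable by simp
    show "integrable (gauss_PiM I) (\<lambda>g. \<bar>(mean_energy \<beta> g - quenched_energy \<beta>) * replica_avg R \<beta> g f\<bar>)"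
      using integrable_mult_bounded [OF int replica_avg_measurable replica_avg] by simp
    show "integrable (gauss_PiM I) (\<lambda>g. \<bar>mean_energy \<beta> g - quenched_energy \<beta>\<bar>)"
      using int by simp
    show "\<bar>(mean_energy \<beta> g - quenched_energy \<beta>) * replica_avg R \<beta> g f\<bar> \<le> \<bar>mean_energy \<beta> g - quenched_energy \<beta>\<bar>" for g
      using mult_left_mono [OF replica_avg, of "\<bar>mean_energy \<beta> g - quenched_energy \<beta>\<bar>"] by (simp add: abs_mult)
  qed
  finally show ?thesis .
qed

end

text \<open>\<open>L i\<close> bounds the sensitivity of the energy to coupling \<open>i\<close>;
  \<open>V\<close> bounds the total variance and will be the volume times the stability
  constant.\<close>

locale bounded_gaussian_gibbs = gaussian_gibbs I S a
  for I :: "'i set" and S :: "'s set" and a +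
  fixes L :: "'i \<Rightarrow> real" and V c0 :: real
  assumes a_le: "\<And>i \<sigma>. i \<in> I \<Longrightarrow> \<sigma> \<in> S \<Longrightarrow> \<bar>a i \<sigma>\<bar> \<le> L i"
    and L_le: "(\<Sum>i\<in>I. (L i)\<^sup>2) \<le> V"
    and cov_diag: "\<And>\<sigma>. \<sigma> \<in> S \<Longrightarrow> cov \<sigma> \<sigma> = c0"
begin

lemma abs_cov_le:
  assumes "\<sigma> \<in> S" "\<tau> \<in> S"
  shows "\<bar>cov \<sigma> \<tau>\<bar> \<le> V"
proof -
  have "\<bar>cov \<sigma> \<tau>\<bar> \<le> (\<Sum>i\<in>I. L i * L i)"
    unfolding cov_def
    by (intro order.trans [OF sum_abs] sum_mono)
       (auto simp: abs_mult intro!: mult_mono a_le assms order.trans [OF abs_ge_zero a_le])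
  then show ?thesis
    using L_le by (simp add: power2_eq_square)
qed

lemma V_nonneg: "0 \<le> V"
  using L_le by (meson order.trans sum_nonneg zero_le_power2)

text \<open>The factor 2 comes from bounding \<open>c0\<close> and the mean overlap by
  \<open>V\<close> separately.\<close>

lemma abs_quenched_energy_le: "\<bar>quenched_energy \<beta>\<bar> \<le> 2 * \<bar>\<beta>\<bar> * V"
proof -
  have "\<bar>quenched_avg 2 \<beta> (\<lambda>s. cov (s 1) (s 2))\<bar> \<le> V"
    by (rule quenched_avg_abs_le) (auto intro!: abs_cov_le)
  moreover have "\<bar>c0\<bar> \<le> V"
    using S_nonempty cov_diag abs_cov_le by fastforce
  ultimately have "\<bar>c0 - quenched_avg 2 \<beta> (\<lambda>s. cov (s 1) (s 2))\<bar> \<le> 2 * V"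
    by linarith
  then have "\<bar>\<beta>\<bar> * \<bar>c0 - quenched_avg 2 \<beta> (\<lambda>s. cov (s 1) (s 2))\<bar> \<le> \<bar>\<beta>\<bar> * (2 * V)"
    by (rule mult_left_mono) simp
  then show ?thesis
    using quenched_energy_eq [of c0 \<beta>] cov_diag by (simp add: abs_mult)
qed

lemma logZ_lipschitz: "\<bar>logZ \<beta> g - logZ \<beta> g'\<bar> \<le> (\<Sum>i\<in>I. (\<bar>\<beta>\<bar> * L i) * \<bar>g i - g' i\<bar>)"
  unfolding logZ_def
proof (rule ln_partition_sum_lipschitz [OF finite_S S_nonempty])
  fix \<sigma> assume \<sigma>: "\<sigma> \<in> S"
  have "\<beta> * energy g \<sigma> - \<beta> * energy g' \<sigma> = (\<Sum>i\<in>I. \<beta> * a i \<sigma> * (g i - g' i))"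
    by (simp add: energy_def sum_distrib_left sum_subtractf algebra_simps)
  also have "\<bar>\<dots>\<bar> \<le> (\<Sum>i\<in>I. (\<bar>\<beta>\<bar> * L i) * \<bar>g i - g' i\<bar>)"
    by (intro order.trans [OF sum_abs] sum_mono)
       (auto simp: abs_mult intro!: mult_right_mono mult_left_mono a_le \<sigma>)
  finally show "\<bar>\<beta> * energy g \<sigma> - \<beta> * energy g' \<sigma>\<bar> \<le> (\<Sum>i\<in>I. (\<bar>\<beta>\<bar> * L i) * \<bar>g i - g' i\<bar>)" .
qed

lemma logZ_integrable: "integrable (gauss_PiM I) (logZ \<beta>)"
  by (rule gauss_PiM_lipschitz_integrable(1) [OF finite_I logZ_measurable logZ_lipschitz])

text \<open>With \<open>V\<close> proportional to the volume, the fluctuation is of the order of the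
  square root of the volume.\<close>

lemma logZ_mean_deviation: "(\<integral>g. \<bar>logZ \<beta> g - pressure \<beta>\<bar> \<partial>gauss_PiM I) \<le> \<bar>\<beta>\<bar> * sqrt V"
proof -
  have "(\<integral>g. \<bar>logZ \<beta> g - pressure \<beta>\<bar> \<partial>gauss_PiM I) \<le> sqrt (\<Sum>i\<in>I. (\<bar>\<beta>\<bar> * L i)\<^sup>2)"
    unfolding pressure_def
    by (rule gauss_PiM_lipschitz_mean_deviation [OF finite_I logZ_measurable logZ_lipschitz])
  also have "\<dots> = \<bar>\<beta>\<bar> * sqrt (\<Sum>i\<in>I. (L i)\<^sup>2)"
    by (simp add: power_mult_distrib real_sqrt_mult flip: sum_distrib_left)
  also have "\<dots> \<le> \<bar>\<beta>\<bar> * sqrt V"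
    using L_le by (intro mult_left_mono) auto
  finally show ?thesis .
qed

lemma pressure_convex: "pressure \<beta> + h * quenched_energy \<beta> \<le> pressure (\<beta> + h)"
proof -
  have "pressure \<beta> + h * quenched_energy \<beta> = (\<integral>g. logZ \<beta> g + h * mean_energy \<beta> g \<partial>gauss_PiM I)"
    using logZ_integrable mean_energy_integrable by (simp add: pressure_def quenched_energy_def)
  also have "\<dots> \<le> pressure (\<beta> + h)"
    unfolding pressure_def using logZ_integrable mean_energy_integrable
    by (intro integral_mono logZ_convex) auto
  finally show ?thesis .
qed

lemma pressure_lipschitz:
  assumes "\<bar>x\<bar> \<le> b" "\<bar>y\<bar> \<le> b"
  shows "\<bar>pressure x - pressure y\<bar> \<le> (2 * b * V) * \<bar>x - y\<bar>"
proof -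
  \<comment> \<open>The tangent at \<open>x\<close> bounds this difference from above only; the
    reverse bound uses the tangent at \<open>y\<close>.\<close>
  have *: "pressure x - pressure y \<le> (2 * b * V) * \<bar>x - y\<bar>" if "\<bar>x\<bar> \<le> b" for x y
  proof -
    have "pressure x - pressure y \<le> \<bar>x - y\<bar> * \<bar>quenched_energy x\<bar>"
      using pressure_convex [of x "y - x"] abs_ge_self [of "(x - y) * quenched_energy x"]
      unfolding abs_mult by (simp add: left_diff_distrib)
    also have "\<dots> \<le> \<bar>x - y\<bar> * (2 * b * V)"
      using that V_nonneg
      by (intro mult_left_mono order.trans [OF abs_quenched_energy_le] mult_right_mono) auto
    finally show ?thesis by (simp add: mult.commute)
  qed
  from * [of x y] * [of y x] assms show ?thesis
    by (simp add: abs_le_iff abs_minus_commute)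
qed

text \<open>Convexity bounds the fluctuation of the derivative of the log-partition function by
  fluctuations of the function itself and a second difference of its mean.\<close>

lemma mean_energy_deviation:
  assumes \<delta>: "0 < \<delta>"
  shows "(\<integral>g. \<bar>mean_energy \<beta> g - quenched_energy \<beta>\<bar> \<partial>gauss_PiM I)
    \<le> ((\<bar>\<beta> + \<delta>\<bar> + \<bar>\<beta>\<bar> + \<bar>\<beta> - \<delta>\<bar>) * sqrt V + (pressure (\<beta> + \<delta>) - 2 * pressure \<beta> + pressure (\<beta> - \<delta>))) / \<delta>"
proof -
  define d where "d x g = \<bar>logZ x g - pressure x\<bar>" for x g
  let ?D = "pressure (\<beta> + \<delta>) - 2 * pressure \<beta> + pressure (\<beta> - \<delta>)"
  have d_int: "integrable (gauss_PiM I) (d x)" for x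
    unfolding d_def using logZ_integrable by auto
  have le: "\<delta> * \<bar>mean_energy \<beta> g - quenched_energy \<beta>\<bar> \<le> d (\<beta> + \<delta>) g + d \<beta> g + d (\<beta> - \<delta>) g + ?D" for g
  proof -
    \<comment> \<open>The forward tangent of \<open>logZ\<close> is paired with the backward tangent
      of \<open>pressure\<close>, and conversely. Replacing \<open>logZ\<close> by
      \<open>pressure\<close> at the three points then leaves exactly the second difference
      \<open>?D\<close>.\<close>
    have "logZ \<beta> g + \<delta> * mean_energy \<beta> g \<le> logZ (\<beta> + \<delta>) g"
      "logZ \<beta> g - \<delta> * mean_energy \<beta> g \<le> logZ (\<beta> - \<delta>) g"
      "pressure \<beta> + \<delta> * quenched_energy \<beta> \<le> pressure (\<beta> + \<delta>)"
      "pressure \<beta> - \<delta> * quenched_energy \<beta> \<le> pressure (\<beta> - \<delta>)"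
      using logZ_convex [of \<beta> g \<delta>] logZ_convex [of \<beta> g "- \<delta>"]
        pressure_convex [of \<beta> \<delta>] pressure_convex [of \<beta> "- \<delta>"] by simp_all
    moreover have "\<delta> * \<bar>mean_energy \<beta> g - quenched_energy \<beta>\<bar> = \<bar>\<delta> * mean_energy \<beta> g - \<delta> * quenched_energy \<beta>\<bar>"
      using \<delta> by (simp add: abs_mult flip: right_diff_distrib)
    ultimately show ?thesis
      unfolding d_def by linarith
  qed
  have "\<delta> * (\<integral>g. \<bar>mean_energy \<beta> g - quenched_energy \<beta>\<bar> \<partial>gauss_PiM I)
      = (\<integral>g. \<delta> * \<bar>mean_energy \<beta> g - quenched_energy \<beta>\<bar> \<partial>gauss_PiM I)"
    by simp
  also have "\<dots> \<le> (\<integral>g. d (\<beta> + \<delta>) g + d \<beta> g + d (\<beta> - \<delta>) g + ?D \<partial>gauss_PiM I)"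
    using d_int mean_energy_integrable by (intro integral_mono le) auto
  also have "\<dots> = (\<integral>g. d (\<beta> + \<delta>) g \<partial>gauss_PiM I) + (\<integral>g. d \<beta> g \<partial>gauss_PiM I)
      + (\<integral>g. d (\<beta> - \<delta>) g \<partial>gauss_PiM I) + ?D"
    using d_int by simp
  also have "\<dots> \<le> \<bar>\<beta> + \<delta>\<bar> * sqrt V + \<bar>\<beta>\<bar> * sqrt V + \<bar>\<beta> - \<delta>\<bar> * sqrt V + ?D"
    unfolding d_def by (intro add_mono logZ_mean_deviation order_refl)
  finally show ?thesis
    using \<delta> by (simp add: field_simps)
qed

lemma GG_integral_bound:
  assumes f: "\<And>k s x. R < k \<Longrightarrow> f (s(k := x)) = f s" and B: "\<And>s. \<bar>f s\<bar> \<le> 1"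
    and \<beta>: "0 < \<beta>1" "\<beta>1 < \<beta>2" and \<delta>: "0 < \<delta>" "\<delta> < 1"
  shows "\<bar>integral {\<beta>1\<^sup>2..\<beta>2\<^sup>2} (\<lambda>t. (\<Sum>k=1..R. quenched_avg (R + 1) (sqrt t) (\<lambda>s. f s * cov (s k) (s (R + 1))))
      - real (R + 1) * quenched_avg (R + 2) (sqrt t) (\<lambda>s. f s * cov (s (R + 1)) (s (R + 2)))
      + quenched_avg R (sqrt t) f * quenched_avg 2 (sqrt t) (\<lambda>s. cov (s 1) (s 2)))\<bar>
    \<le> 6 * (\<beta>2 - \<beta>1) * (\<beta>2 + 1) * sqrt V / \<delta> + 16 * (\<beta>2 + 1) * V * \<delta>"
    (is "\<bar>integral ?T (\<lambda>t. ?F (sqrt t))\<bar> \<le> ?bound")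
\<comment> \<open>The integral of a non-integrable function is 0 by convention, which settles that
  case without any study of the integrand as a function of \<beta>.\<close>
proof (cases "(\<lambda>t. ?F (sqrt t)) integrable_on ?T")
  case False
  then show ?thesis
    using \<beta> \<delta> V_nonneg by (simp add: not_integrable_integral)
next
  case True
  define D where "D x = pressure (x + \<delta>) - 2 * pressure x + pressure (x - \<delta>)" for x
  \<comment> \<open>\<open>3 * (\<beta>2 + 1)\<close> bounds the sum of the three moduli in
    \<open>mean_energy_deviation\<close> for \<open>x\<close> in \<open>{\<beta>1..\<beta>2}\<close>
    and \<delta> below 1.\<close>
  define W where "W x = (3 * (\<beta>2 + 1) * sqrt V + D x) / \<delta>" for x
  have lip: "\<bar>pressure x - pressure y\<bar> \<le> (2 * (\<beta>2 + 1) * V) * \<bar>x - y\<bar>"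
    if "x \<in> {\<beta>1 - 1..\<beta>2 + 1}" "y \<in> {\<beta>1 - 1..\<beta>2 + 1}" for x y
    using that \<beta> by (intro pressure_lipschitz) auto
  note D = second_difference_integral_le [OF lip less_imp_le [OF \<beta>(2)] \<delta>, folded D_def]
  have W: "\<bar>?F x\<bar> \<le> W x / x" if x: "x \<in> {\<beta>1..\<beta>2}" for x
  proof -
    have "x * \<bar>?F x\<bar> = \<bar>x * ?F x\<bar>"
      using x \<beta> by (simp add: abs_mult)
    also have "\<dots> \<le> ((\<bar>x + \<delta>\<bar> + \<bar>x\<bar> + \<bar>x - \<delta>\<bar>) * sqrt V + D x) / \<delta>"
      unfolding D_def
      by (rule order.trans [OF abs_GG_le [where R = R and f = f, OF f B cov_diag] mean_energy_deviation [OF \<delta>(1)]])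
    also have "\<dots> \<le> W x"
      unfolding W_def using x \<beta> \<delta> V_nonneg
      by (intro divide_right_mono add_mono mult_right_mono) auto
    finally show ?thesis
      using x \<beta> by (simp add: field_simps)
  qed
  have sqrt_in: "sqrt t \<in> {\<beta>1..\<beta>2}" if "t \<in> ?T" for t
    using that \<beta> real_le_rsqrt [of \<beta>1 t] real_sqrt_le_mono [of t "\<beta>2\<^sup>2"] by simp
  have contW: "continuous_on {\<beta>1..\<beta>2} W"
    unfolding W_def using D(1) \<delta> by (intro continuous_intros) auto
  \<comment> \<open>The estimate \<open>W x / x\<close> at \<open>x = sqrt t\<close> is twice
    \<open>W\<close> times the derivative of \<open>sqrt\<close>, so the substitution leaves the
    plain integral of \<open>W\<close>.\<close>
  have "((\<lambda>t. (inverse (sqrt t) / 2) *\<^sub>R W (sqrt t)) has_integral integral {sqrt (\<beta>1\<^sup>2)..sqrt (\<beta>2\<^sup>2)} W) ?T"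
  proof (rule has_integral_substitution [OF _ _ _ contW])
    show "\<beta>1\<^sup>2 \<le> \<beta>2\<^sup>2" using \<beta> by (intro power_mono) auto
    show "sqrt (\<beta>1\<^sup>2) \<le> sqrt (\<beta>2\<^sup>2)" using \<beta> by simp
    show "sqrt ` ?T \<subseteq> {\<beta>1..\<beta>2}"
      using sqrt_in by blast
    show "(sqrt has_real_derivative inverse (sqrt t) / 2) (at t within ?T)" if "t \<in> ?T" for t
      using that \<beta> by (intro DERIV_real_sqrt [THEN DERIV_subset]) (auto intro: less_le_trans [of 0 "\<beta>1\<^sup>2"])
  qed
  then have sub: "((\<lambda>t. 2 * (inverse (sqrt t) / 2 * W (sqrt t))) has_integral 2 * integral {\<beta>1..\<beta>2} W) ?T"
    using \<beta> by (intro has_integral_mult_right) simp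
  have "\<bar>integral ?T (\<lambda>t. ?F (sqrt t))\<bar> \<le> integral ?T (\<lambda>t. 2 * (inverse (sqrt t) / 2 * W (sqrt t)))"
  proof (rule integral_norm_bound_integral [of "\<lambda>t. ?F (sqrt t)", simplified real_norm_def])
    show "\<bar>?F (sqrt t)\<bar> \<le> 2 * (inverse (sqrt t) / 2 * W (sqrt t))" if "t \<in> ?T" for t
    proof -
      from W [OF sqrt_in [OF that]] show ?thesis
        by (simp only: divide_inverse) (simp add: mult.commute)
    qed
  qed (use True sub in auto)
  also have "\<dots> = 2 * integral {\<beta>1..\<beta>2} W"
    using sub by (rule integral_unique)
  also have "integral {\<beta>1..\<beta>2} W = ((\<beta>2 - \<beta>1) * (3 * (\<beta>2 + 1) * sqrt V) + integral {\<beta>1..\<beta>2} D) / \<delta>"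
  proof -
    have "(D has_integral integral {\<beta>1..\<beta>2} D) {\<beta>1..\<beta>2}"
      using integrable_continuous_real [OF D(1)] by (rule integrable_integral)
    from has_integral_divide [OF has_integral_add [OF has_integral_const_real this], of "3 * (\<beta>2 + 1) * sqrt V" \<delta>]
    show ?thesis
      using \<beta> by (intro integral_unique) (simp add: W_def [abs_def])
  qed
  \<comment> \<open>Here \<open>K\<close> is \<open>2 * (\<beta>2 + 1) * V\<close>, so the second
    difference contributes \<open>2 * 4 * 2 = 16\<close>; the constant 6 is twice the 3 in
    \<open>W\<close>.\<close>
  also have "2 * \<dots> \<le> 2 * (((\<beta>2 - \<beta>1) * (3 * (\<beta>2 + 1) * sqrt V) + 4 * (2 * (\<beta>2 + 1) * V) * \<delta>\<^sup>2) / \<delta>)"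
    using D(2) \<delta> by (intro mult_left_mono divide_right_mono add_left_mono) auto
  also have "\<dots> = ?bound"
    using \<delta> by (simp add: field_simps power2_eq_square)
  finally show ?thesis .
qed

end

section \<open>Spin glasses\<close>

lemma abs_sigmaX:
  assumes "\<sigma> \<in> configs \<Lambda>" "X \<subseteq> \<Lambda>"
  shows "\<bar>sigmaX \<sigma> X\<bar> = (if X = {} then 0 else 1)"
proof -
  have "\<bar>\<sigma> i\<bar> = 1" if "i \<in> X" for i
  proof -
    have "\<sigma> i \<in> {-1, 1}"
      using assms that unfolding configs_def by (intro PiE_mem [of \<sigma> \<Lambda>]) auto
    then show ?thesis by auto
  qed
  then show ?thesis
    by (simp add: sigmaX_def abs_prod)
qed

text \<open>The Lipschitz constants and the diagonal covariance see spin products only through their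
  absolute values. The empty set is missing from the diagonal because its spin product is 0 by
  convention.\<close>

lemma bounded_gaussian_gibbs_spin_glass:
  assumes "finite \<Lambda>" and nonneg: "\<And>X. 0 \<le> Delta2 X" and V: "(\<Sum>X\<in>Pow \<Lambda>. Delta2 X) \<le> V"
  shows "bounded_gaussian_gibbs (Pow \<Lambda>) (configs \<Lambda>) (\<lambda>X \<sigma>. sqrt (Delta2 X) * sigmaX \<sigma> X)
    (\<lambda>X. sqrt (Delta2 X)) V (\<Sum>X\<in>Pow \<Lambda> - {{}}. Delta2 X)"
proof -
  interpret gaussian_gibbs "Pow \<Lambda>" "configs \<Lambda>" "\<lambda>X \<sigma>. sqrt (Delta2 X) * sigmaX \<sigma> X"
    using assms by unfold_locales (auto simp: configs_def PiE_eq_empty_iff intro!: finite_PiE)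
  show ?thesis
  proof
    show "\<bar>sqrt (Delta2 X) * sigmaX \<sigma> X\<bar> \<le> sqrt (Delta2 X)"
      if "X \<in> Pow \<Lambda>" "\<sigma> \<in> configs \<Lambda>" for X \<sigma>
      using that nonneg abs_sigmaX [of \<sigma> \<Lambda> X] by (simp add: abs_mult)
    show "(\<Sum>X\<in>Pow \<Lambda>. (sqrt (Delta2 X))\<^sup>2) \<le> V"
      using V nonneg by simp
    show "cov \<sigma> \<sigma> = (\<Sum>X\<in>Pow \<Lambda> - {{}}. Delta2 X)" if \<sigma>: "\<sigma> \<in> configs \<Lambda>" for \<sigma>
    proof -
      have "cov \<sigma> \<sigma> = (\<Sum>X\<in>Pow \<Lambda>. Delta2 X * \<bar>sigmaX \<sigma> X\<bar>\<^sup>2)"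
        unfolding cov_def using nonneg
        by (intro sum.cong refl) (simp add: power2_eq_square mult.left_commute mult.assoc flip: mult.assoc [of "sqrt _"])
      also have "\<dots> = (\<Sum>X\<in>Pow \<Lambda>. if X = {} then 0 else Delta2 X)"
        using \<sigma> by (intro sum.cong refl) (simp add: abs_sigmaX)
      also have "\<dots> = (\<Sum>X\<in>Pow \<Lambda> - {{}}. Delta2 X)"
        using assms(1) by (intro sum.mono_neutral_cong_right) auto
      finally show ?thesis .
    qed
  qed
qed

text \<open>The overlap matrix reads only replicas \<open>1..R\<close>; this supplies the
  independence from later replicas demanded of \<open>f\<close> above.\<close>

lemma ovm_fun_upd: "R < k \<Longrightarrow> ovm Delta2 \<Lambda> R (s(k := x)) = ovm Delta2 \<Lambda> R s"
  by (auto simp: ovm_def fun_eq_iff)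

text \<open>The signs meet here: \<open>- \<beta> * ham\<close> is \<open>\<beta> * energy\<close>,
  with the standard deviation moved from the coupling into the coefficient.\<close>

lemma quenched_eq_quenched_avg:
  assumes "gaussian_gibbs (Pow \<Lambda>) (configs \<Lambda>)"
  shows "quenched Delta2 \<Lambda> \<beta> n f =
    gaussian_gibbs.quenched_avg (Pow \<Lambda>) (configs \<Lambda>) (\<lambda>X \<sigma>. sqrt (Delta2 X) * sigmaX \<sigma> X) n \<beta> f"
proof -
  interpret gaussian_gibbs "Pow \<Lambda>" "configs \<Lambda>" "\<lambda>X \<sigma>. sqrt (Delta2 X) * sigmaX \<sigma> X" by fact
  have ham: "- \<beta> * ham \<Lambda> (\<lambda>X. sqrt (Delta2 X) * g X) \<sigma> = \<beta> * energy g \<sigma>" for g \<sigma>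
    unfolding ham_def energy_def by (simp add: ac_simps)
  have "gibbs n \<Lambda> (\<lambda>X. sqrt (Delta2 X) * g X) \<beta> f = replica_avg n \<beta> g f" for g
    by (simp only: gibbs_def partition_fn_def replica_avg_def gibbs_avg_def sum_distrib_left ham)
  then show ?thesis
    by (simp add: quenched_def Av_def quenched_avg_def)
qed

lemma cov_eq_ncov:
  assumes "gaussian_gibbs (Pow \<Lambda>) (configs \<Lambda>)"
    and nonneg: "\<And>X. 0 \<le> Delta2 X" and "0 < card \<Lambda>"
  shows "gaussian_gibbs.cov (Pow \<Lambda>) (\<lambda>X \<sigma>. sqrt (Delta2 X) * sigmaX \<sigma> X) \<sigma> \<tau> = real (card \<Lambda>) * ncov Delta2 \<Lambda> \<sigma> \<tau>"
proof -
  interpret gaussian_gibbs "Pow \<Lambda>" "configs \<Lambda>" "\<lambda>X \<sigma>. sqrt (Delta2 X) * sigmaX \<sigma> X" by fact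
  have "sqrt (Delta2 X) * p * (sqrt (Delta2 X) * q) = Delta2 X * p * q" for X p q
    using nonneg [of X] by (simp add: algebra_simps flip: mult.assoc [of "sqrt (Delta2 X)" "sqrt (Delta2 X)"])
  then show ?thesis
    using assms(3) by (simp only: cov_def ncov_def) simp
qed

lemma spin_glass_integral_bounds:
  fixes Delta2 :: "('d \<Rightarrow> int) set \<Rightarrow> real" and G :: "(nat \<Rightarrow> nat \<Rightarrow> real) \<Rightarrow> real"
  assumes nonneg: "\<And>X. 0 \<le> Delta2 X" and card: "0 < card \<Lambda>"
    and c: "(\<Sum>X\<in>Pow \<Lambda>. Delta2 X) \<le> real (card \<Lambda>) * c"
    and G: "\<And>M. \<bar>G M\<bar> \<le> 1" and \<beta>: "0 < \<beta>1" "\<beta>1 < \<beta>2" and \<delta>: "0 < \<delta>" "\<delta> < 1"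
  shows "\<bar>integral {\<beta>1\<^sup>2..\<beta>2\<^sup>2} (\<lambda>t. quenched Delta2 \<Lambda> (sqrt t) (R + 2)
              (\<lambda>s. (\<Sum>k=1..R. \<Sum>l\<in>{1..R} - {k}. G (ovm Delta2 \<Lambda> R s) * ovl Delta2 \<Lambda> s l k)
                   - 2 * real R * G (ovm Delta2 \<Lambda> R s) * (\<Sum>l=1..R. ovl Delta2 \<Lambda> s l (R + 1))
                   + real R * real (R + 1) * G (ovm Delta2 \<Lambda> R s) * ovl Delta2 \<Lambda> s (R + 1) (R + 2)))\<bar>
      \<le> 4 / real (card \<Lambda>)" (is "\<bar>integral _ (\<lambda>t. quenched _ _ _ _ ?T)\<bar> \<le> _")
    and "\<bar>integral {\<beta>1\<^sup>2..\<beta>2\<^sup>2} (\<lambda>t.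
                (\<Sum>k=1..R. quenched Delta2 \<Lambda> (sqrt t) (R + 1)
                    (\<lambda>s. G (ovm Delta2 \<Lambda> R s) * ovl Delta2 \<Lambda> s k (R + 1)))
              - real (R + 1) * quenched Delta2 \<Lambda> (sqrt t) (R + 2)
                    (\<lambda>s. G (ovm Delta2 \<Lambda> R s) * ovl Delta2 \<Lambda> s (R + 1) (R + 2))
              + quenched Delta2 \<Lambda> (sqrt t) R (\<lambda>s. G (ovm Delta2 \<Lambda> R s))
                * quenched Delta2 \<Lambda> (sqrt t) 2 (\<lambda>s. ovl Delta2 \<Lambda> s 1 2))\<bar>
      \<le> 6 * (\<beta>2 - \<beta>1) * (\<beta>2 + 1) * sqrt c / (\<delta> * sqrt (real (card \<Lambda>))) + 16 * (\<beta>2 + 1) * c * \<delta>"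
      (is "\<bar>integral _ ?F\<bar> \<le> _")
proof -
  let ?N = "real (card \<Lambda>)"
  define f where "f s = G (ovm Delta2 \<Lambda> R s)" for s
  have N: "0 < ?N" and "finite \<Lambda>"
    using card card_ge_0_finite by auto
  then interpret bounded_gaussian_gibbs "Pow \<Lambda>" "configs \<Lambda>" "\<lambda>X \<sigma>. sqrt (Delta2 X) * sigmaX \<sigma> X"
    "\<lambda>X. sqrt (Delta2 X)" "?N * c" "\<Sum>X\<in>Pow \<Lambda> - {{}}. Delta2 X"
    using bounded_gaussian_gibbs_spin_glass nonneg c by blast
  have quenched: "quenched Delta2 \<Lambda> \<beta> n h = quenched_avg n \<beta> h" for \<beta> n h
    by (rule quenched_eq_quenched_avg) (rule gaussian_gibbs_axioms)
  have cov: "cov (s k) (s l) = ?N * ovl Delta2 \<Lambda> s k l" for s k l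
    unfolding ovl_def by (rule cov_eq_ncov [OF gaussian_gibbs_axioms nonneg card])
  have f: "\<And>k s x. R < k \<Longrightarrow> f (s(k := x)) = f s" "\<And>s. \<bar>f s\<bar> \<le> 1"
    by (simp_all add: f_def ovm_fun_upd G)
  \<comment> \<open>The abstract bounds concern unnormalised covariances. Apart from the overlaps
    inside \<open>G\<close>, both integrands are linear in the overlaps, so a common factor
    \<open>?N\<close> comes out.\<close>
  have "\<bar>integral {\<beta>1\<^sup>2..\<beta>2\<^sup>2} (\<lambda>t. ?N * quenched_avg (R + 2) (sqrt t) ?T)\<bar> \<le> 4"
  proof -
    have "(\<lambda>s. (\<Sum>k=1..R. \<Sum>l\<in>{1..R} - {k}. f s * cov (s l) (s k))
      - 2 * real R * f s * (\<Sum>l=1..R. cov (s l) (s (R + 1)))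
      + real R * real (R + 1) * f s * cov (s (R + 1)) (s (R + 2))) = (\<lambda>s. ?N * ?T s)" (is "?U = _")
      unfolding cov f_def by (simp add: algebra_simps sum_distrib_left)
    moreover have "\<bar>integral {\<beta>1\<^sup>2..\<beta>2\<^sup>2} (\<lambda>t. quenched_avg (R + 2) (sqrt t) ?U)\<bar> \<le> 4"
      by (rule stability_integral_bound [OF f cov_diag \<beta>])
    ultimately show ?thesis
      by (simp only: quenched_avg_cmult)
  qed
  then have "?N * \<bar>integral {\<beta>1\<^sup>2..\<beta>2\<^sup>2} (\<lambda>t. quenched_avg (R + 2) (sqrt t) ?T)\<bar> \<le> 4"
    by (simp add: abs_mult)
  then show "\<bar>integral {\<beta>1\<^sup>2..\<beta>2\<^sup>2} (\<lambda>t. quenched Delta2 \<Lambda> (sqrt t) (R + 2) ?T)\<bar> \<le> 4 / ?N"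
    unfolding quenched using N by (simp only: pos_le_divide_eq mult.commute)
  have "\<bar>integral {\<beta>1\<^sup>2..\<beta>2\<^sup>2} (\<lambda>t. ?N * ?F t)\<bar>
     \<le> 6 * (\<beta>2 - \<beta>1) * (\<beta>2 + 1) * sqrt (?N * c) / \<delta> + 16 * (\<beta>2 + 1) * (?N * c) * \<delta>"
  proof -
    have *: "h s * (?N * x) = ?N * (h s * x)" for h :: "(nat \<Rightarrow> ('d \<Rightarrow> int) \<Rightarrow> real) \<Rightarrow> real" and s x
      by simp
    have "(\<lambda>t. (\<Sum>k=1..R. quenched_avg (R + 1) (sqrt t) (\<lambda>s. f s * cov (s k) (s (R + 1))))
      - real (R + 1) * quenched_avg (R + 2) (sqrt t) (\<lambda>s. f s * cov (s (R + 1)) (s (R + 2)))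
      + quenched_avg R (sqrt t) f * quenched_avg 2 (sqrt t) (\<lambda>s. cov (s 1) (s 2))) = (\<lambda>t. ?N * ?F t)" (is "?U = _")
      unfolding cov quenched * quenched_avg_cmult f_def [symmetric]
      by (simp add: algebra_simps sum_distrib_left)
    moreover have "\<bar>integral {\<beta>1\<^sup>2..\<beta>2\<^sup>2} ?U\<bar>
     \<le> 6 * (\<beta>2 - \<beta>1) * (\<beta>2 + 1) * sqrt (?N * c) / \<delta> + 16 * (\<beta>2 + 1) * (?N * c) * \<delta>"
      by (rule GG_integral_bound [OF f \<beta> \<delta>])
    ultimately show ?thesis
      by (simp only:)
  qed
  then have "?N * \<bar>integral {\<beta>1\<^sup>2..\<beta>2\<^sup>2} ?F\<bar>
     \<le> 6 * (\<beta>2 - \<beta>1) * (\<beta>2 + 1) * sqrt (?N * c) / \<delta> + 16 * (\<beta>2 + 1) * (?N * c) * \<delta>"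
    by (simp add: abs_mult)
  also have "\<dots> = ?N * (6 * (\<beta>2 - \<beta>1) * (\<beta>2 + 1) * sqrt c / (\<delta> * sqrt ?N) + 16 * (\<beta>2 + 1) * c * \<delta>)"
  proof -
    \<comment> \<open>The concentration term grows only like the square root of \<open>?N\<close>,
      so dividing by \<open>?N\<close> leaves a decay of \<open>1 / sqrt ?N\<close>.\<close>
    have "sqrt (?N * c) / \<delta> = ?N * (sqrt c / (\<delta> * sqrt ?N))"
      using \<delta> N by (simp add: real_sqrt_mult field_simps)
    then show ?thesis
      by (simp add: distrib_left mult.left_commute flip: times_divide_eq_right)
  qed
  finally show "\<bar>integral {\<beta>1\<^sup>2..\<beta>2\<^sup>2} ?F\<bar>
      \<le> 6 * (\<beta>2 - \<beta>1) * (\<beta>2 + 1) * sqrt c / (\<delta> * sqrt ?N) + 16 * (\<beta>2 + 1) * c * \<delta>"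
    using N by (simp only: mult_le_cancel_left_pos)
qed

section \<open>The thermodynamic limit\<close>

theorem theorem1:
  fixes Delta2 :: "('d::finite \<Rightarrow> int) set \<Rightarrow> real"
    and R :: nat and G :: "(nat \<Rightarrow> nat \<Rightarrow> real) \<Rightarrow> real" and \<beta>1 \<beta>2 :: real
  assumes "\<forall>X. Delta2 X \<ge> 0"
    and "\<forall>X a. Delta2 (translate a X) = Delta2 X"
    and "thermo_stable Delta2"
    and "R \<ge> 1"
    and "observable R G"
    and "0 < \<beta>1" and "\<beta>1 < \<beta>2"
  shows "(\<forall>\<epsilon>>0. \<exists>N. \<forall>\<Lambda>. box \<Lambda> \<and> card \<Lambda> \<ge> N \<longrightarrow>
           \<bar>integral {\<beta>1\<^sup>2..\<beta>2\<^sup>2} (\<lambda>t. quenched Delta2 \<Lambda> (sqrt t) (R + 2)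
              (\<lambda>s. (\<Sum>k=1..R. \<Sum>l\<in>{1..R} - {k}. G (ovm Delta2 \<Lambda> R s) * ovl Delta2 \<Lambda> s l k)
                   - 2 * real R * G (ovm Delta2 \<Lambda> R s) * (\<Sum>l=1..R. ovl Delta2 \<Lambda> s l (R + 1))
                   + real R * real (R + 1) * G (ovm Delta2 \<Lambda> R s) * ovl Delta2 \<Lambda> s (R + 1) (R + 2)))\<bar> < \<epsilon>)
       \<and> (\<forall>\<epsilon>>0. \<exists>N. \<forall>\<Lambda>. box \<Lambda> \<and> card \<Lambda> \<ge> N \<longrightarrow>
           \<bar>integral {\<beta>1\<^sup>2..\<beta>2\<^sup>2} (\<lambda>t.
                (\<Sum>k=1..R. quenched Delta2 \<Lambda> (sqrt t) (max R (R + 1))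
                    (\<lambda>s. G (ovm Delta2 \<Lambda> R s) * ovl Delta2 \<Lambda> s k (R + 1)))
              - real (R + 1) * quenched Delta2 \<Lambda> (sqrt t) (max R (R + 2))
                    (\<lambda>s. G (ovm Delta2 \<Lambda> R s) * ovl Delta2 \<Lambda> s (R + 1) (R + 2))
              + quenched Delta2 \<Lambda> (sqrt t) R (\<lambda>s. G (ovm Delta2 \<Lambda> R s))
                * quenched Delta2 \<Lambda> (sqrt t) 2 (\<lambda>s. ovl Delta2 \<Lambda> s 1 2))\<bar> < \<epsilon>)"
proof -
  have nonneg: "\<And>X. 0 \<le> Delta2 X"
    using assms(1) by blast
  have G: "\<And>M. \<bar>G M\<bar> \<le> 1"
    using assms(5) by (simp add: observable_def)
  have max_eq: "max R (R + 1) = R + 1" "max R (R + 2) = R + 2"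
    by auto
  obtain cbar where cbar: "\<And>\<Lambda>. box \<Lambda> \<Longrightarrow> (\<Sum>X\<in>Pow \<Lambda>. Delta2 X) / real (card \<Lambda>) \<le> cbar"
    using assms(3) by (auto simp: thermo_stable_def)
  \<comment> \<open>The stability constant is made nonnegative so that \<open>C1\<close> and
    \<open>C2\<close> below are nonnegative.\<close>
  define c where "c = max cbar 0"
  have c0: "0 \<le> c"
    by (simp add: c_def)
  have c: "(\<Sum>X\<in>Pow \<Lambda>. Delta2 X) \<le> real (card \<Lambda>) * c" if "box \<Lambda>" "0 < card \<Lambda>" for \<Lambda>
  proof -
    have "(\<Sum>X\<in>Pow \<Lambda>. Delta2 X) / real (card \<Lambda>) \<le> c"
      using cbar [OF that(1)] by (simp add: c_def)
    then show ?thesis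
      using that(2) by (simp add: divide_le_eq mult.commute)
  qed
  show ?thesis
    unfolding max_eq
  proof (intro conjI allI impI, goal_cases)
    case (1 \<epsilon>)
    obtain N where N: "4 / \<epsilon> < real N"
      using reals_Archimedean2 by blast
    \<comment> \<open>A positive threshold forces \<open>card \<Lambda>\<close> to be positive,
      which division by the volume requires.\<close>
    have N0: "0 < N"
      using N 1 by (metis divide_pos_pos not_gr_zero of_nat_0 order.asym zero_less_numeral)
    show ?case
    proof (intro exI allI impI)
      fix \<Lambda> :: "('d \<Rightarrow> int) set"
      assume \<Lambda>: "box \<Lambda> \<and> N \<le> card \<Lambda>"
      then have pos: "0 < card \<Lambda>"
        using N0 by simp
      have "4 / \<epsilon> < real (card \<Lambda>)"
        using N \<Lambda> by (meson less_le_trans of_nat_le_iff)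
      then have "4 / real (card \<Lambda>) < \<epsilon>"
        using 1 pos by (simp add: field_simps)
      moreover have "\<bar>integral {\<beta>1\<^sup>2..\<beta>2\<^sup>2} (\<lambda>t. quenched Delta2 \<Lambda> (sqrt t) (R + 2)
              (\<lambda>s. (\<Sum>k=1..R. \<Sum>l\<in>{1..R} - {k}. G (ovm Delta2 \<Lambda> R s) * ovl Delta2 \<Lambda> s l k)
                   - 2 * real R * G (ovm Delta2 \<Lambda> R s) * (\<Sum>l=1..R. ovl Delta2 \<Lambda> s l (R + 1))
                   + real R * real (R + 1) * G (ovm Delta2 \<Lambda> R s) * ovl Delta2 \<Lambda> s (R + 1) (R + 2)))\<bar>
          \<le> 4 / real (card \<Lambda>)" (is "?I \<le> _")
        using c pos \<Lambda> by (intro spin_glass_integral_bounds(1) [where \<delta> = "1/2"] nonneg G assms(6,7)) auto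
      ultimately show "?I < \<epsilon>"
        by (rule le_less_trans [rotated])
    qed
  next
    case (2 \<epsilon>)
    define C1 where "C1 = 6 * (\<beta>2 - \<beta>1) * (\<beta>2 + 1) * sqrt c"
    define C2 where "C2 = 16 * (\<beta>2 + 1) * c"
    have C: "0 \<le> C1" "0 \<le> C2"
      using c0 assms(6,7) by (auto simp: C1_def C2_def)
    \<comment> \<open>This choice keeps the term linear in \<delta> below
      \<open>\<epsilon> / 2\<close> at every volume. The added 1 avoids a zero denominator, and the
      cap \<open>1/2\<close> keeps \<delta> below 1.\<close>
    define \<delta> where "\<delta> = min (1/2) (\<epsilon> / (2 * (C2 + 1)))"
    have \<delta>: "0 < \<delta>" "\<delta> < 1"
      using 2 C by (auto simp: \<delta>_def)
    have "C2 * \<delta> \<le> C2 * (\<epsilon> / (2 * (C2 + 1)))"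
      using C by (intro mult_left_mono) (auto simp: \<delta>_def)
    also have "\<dots> < \<epsilon> / 2"
      using 2 C by (simp add: field_simps)
    finally have C2\<delta>: "C2 * \<delta> < \<epsilon> / 2" .
    \<comment> \<open>With \<delta> fixed, this threshold makes the remaining term
      \<open>C1 / (\<delta> * sqrt (card \<Lambda>))\<close> at most
      \<open>\<epsilon> / 2\<close>.\<close>
    obtain N where N: "(2 * C1 / (\<epsilon> * \<delta>))\<^sup>2 < real N"
      using reals_Archimedean2 by blast
    then have N0: "0 < N"
      by (metis not_gr_zero not_less of_nat_0 zero_le_power2)
    show ?case
    proof (intro exI allI impI)
      fix \<Lambda> :: "('d \<Rightarrow> int) set"
      assume \<Lambda>: "box \<Lambda> \<and> N \<le> card \<Lambda>"
      then have pos: "0 < card \<Lambda>"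
        using N0 by simp
      have "(2 * C1 / (\<epsilon> * \<delta>))\<^sup>2 \<le> real (card \<Lambda>)"
        using N \<Lambda> by (meson less_le_trans of_nat_le_iff less_imp_le)
      then have "2 * C1 / (\<epsilon> * \<delta>) \<le> sqrt (real (card \<Lambda>))"
        by (rule real_le_rsqrt)
      then have "C1 / (\<delta> * sqrt (real (card \<Lambda>))) \<le> \<epsilon> / 2"
        using 2 \<delta> pos by (simp add: field_simps)
      then have "C1 / (\<delta> * sqrt (real (card \<Lambda>))) + C2 * \<delta> < \<epsilon>"
        using C2\<delta> by linarith
      moreover have "\<bar>integral {\<beta>1\<^sup>2..\<beta>2\<^sup>2} (\<lambda>t.
                (\<Sum>k=1..R. quenched Delta2 \<Lambda> (sqrt t) (R + 1)
                    (\<lambda>s. G (ovm Delta2 \<Lambda> R s) * ovl Delta2 \<Lambda> s k (R + 1)))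
              - real (R + 1) * quenched Delta2 \<Lambda> (sqrt t) (R + 2)
                    (\<lambda>s. G (ovm Delta2 \<Lambda> R s) * ovl Delta2 \<Lambda> s (R + 1) (R + 2))
              + quenched Delta2 \<Lambda> (sqrt t) R (\<lambda>s. G (ovm Delta2 \<Lambda> R s))
                * quenched Delta2 \<Lambda> (sqrt t) 2 (\<lambda>s. ovl Delta2 \<Lambda> s 1 2))\<bar>
          \<le> C1 / (\<delta> * sqrt (real (card \<Lambda>))) + C2 * \<delta>" (is "?I \<le> _")
        unfolding C1_def C2_def
        using c pos \<Lambda> by (intro spin_glass_integral_bounds(2) nonneg G assms(6,7) \<delta>) auto
      ultimately show "?I < \<epsilon>"
        by (rule le_less_trans [rotated])
    qed
  qed
qed

end
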